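(* Suppose $\partial\Omega$ is $C^2$ and there exists $\epsilon>0$ such that we know $g(s,r)$ for all $(s,r)\in[0,L)\times(0,\epsilon)$. This information is enough to determine the curvature of every point on $\partial\Omega$. In particular, if $\gamma:[0,L)\to\partial\Omega$ is a counterclockwise arclength parameterization of $\partial\Omega$, then for every $s\in[0,L)$ $$\kappa(\gamma(s))=-3\pi\lim_{r\to0}\frac{\partial}{\partial r}\,\frac{g(s,r)}{\pi r^2}.$$
   Context: $\Omega\subset\mathbb{R}^2$ is a compact set whose boundary $\partial\Omega$ is a simple closed curve of length $L$, parameterized by arclength by $\gamma$, counterclockwise (interior of $\Omega$ on the left). $g(s,r)=\mathrm{Area}(\Omega\cap D(\gamma(s),r))$, where $D(p,r)$ is the closed disk of radius $r$ centered at $p$. $\kappa$ is the signed curvature of $\partial\Omega$ with respect to the counterclockwise orientation (so that it equals $1/R$ when $\Omega$ is a disk of radius $R$). *)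

theory Defs
  imports "HOL-Analysis.Analysis"
begin

text \<open>
  A closed curve of length \<open>L\<close> is represented by an \<open>L\<close>-periodic map on the whole real line,
  so that regularity is also required at the point where the curve closes up. Parameterizations
  on \<open>[0,L)\<close> are the restrictions of these maps.
\<close>

definition velocity :: "(real \<Rightarrow> real^2) \<Rightarrow> real \<Rightarrow> real^2" where
  "velocity \<gamma> s = vector_derivative \<gamma> (at s)"

definition acceleration :: "(real \<Rightarrow> real^2) \<Rightarrow> real \<Rightarrow> real^2" where
  "acceleration \<gamma> s = vector_derivative (velocity \<gamma>) (at s)"

text \<open>Counterclockwise rotation by a right angle.\<close>

definition rot90 :: "real^2 \<Rightarrow> real^2" where
  "rot90 v = vector [- (v $ 2), v $ 1]"

definition C2_curve :: "(real \<Rightarrow> real^2) \<Rightarrow> bool" where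
  "C2_curve \<gamma> \<longleftrightarrow> \<gamma> C1_differentiable_on UNIV \<and> velocity \<gamma> C1_differentiable_on UNIV"

definition simple_closed_arclength_curve :: "real \<Rightarrow> (real \<Rightarrow> real^2) \<Rightarrow> bool" where
  "simple_closed_arclength_curve L \<gamma> \<longleftrightarrow>
     L > 0 \<and> (\<forall>s. \<gamma> (s + L) = \<gamma> s) \<and> inj_on \<gamma> {0..<L} \<and> (\<forall>s. norm (velocity \<gamma> s) = 1)"

text \<open>
  Counterclockwise orientation: short segments issuing from the curve along the left unit
  normal run inside \<open>\<Omega>\<close>. This also excludes the degenerate case in which the compact
  set \<open>\<Omega>\<close> is the curve itself.
\<close>

definition interior_on_left :: "(real^2) set \<Rightarrow> (real \<Rightarrow> real^2) \<Rightarrow> bool" where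
  "interior_on_left \<Omega> \<gamma> \<longleftrightarrow>
     (\<forall>s. \<forall>\<^sub>F t in at_right 0. \<gamma> s + t *\<^sub>R rot90 (velocity \<gamma> s) \<in> interior \<Omega>)"

definition C2_region :: "(real^2) set \<Rightarrow> real \<Rightarrow> (real \<Rightarrow> real^2) \<Rightarrow> bool" where
  "C2_region \<Omega> L \<gamma> \<longleftrightarrow>
     compact \<Omega> \<and> simple_closed_arclength_curve L \<gamma> \<and> C2_curve \<gamma> \<and>
     frontier \<Omega> = \<gamma> ` {0..<L} \<and> interior_on_left \<Omega> \<gamma>"

definition disk_area :: "(real^2) set \<Rightarrow> (real \<Rightarrow> real^2) \<Rightarrow> real \<Rightarrow> real \<Rightarrow> real" where
  "disk_area \<Omega> \<gamma> s r = measure lebesgue (\<Omega> \<inter> cball (\<gamma> s) r)"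

text \<open>
  Signed curvature at \<open>\<gamma> s\<close> of a unit-speed curve: the component of \<open>\<gamma>''\<close> along the left unit
  normal. It equals \<open>1/R\<close> for a counterclockwise circle of radius \<open>R\<close>.
\<close>

definition signed_curvature :: "(real \<Rightarrow> real^2) \<Rightarrow> real \<Rightarrow> real" where
  "signed_curvature \<gamma> s = acceleration \<gamma> s \<bullet> rot90 (velocity \<gamma> s)"

end

theory Submission
  imports Defs
begin

text \<open>
  Fix a boundary point and take the tangent and the left normal there as coordinate axes. Near the
  point the boundary is the graph of a function \<open>f\<close> with \<open>f 0 = f' 0 = 0\<close>
  (\<open>curve_is_graph\<close>). The rest of the curve stays away (\<open>simple_closed_curve_near_point\<close>), so the
  region is, up to the graph itself, exactly the set above the graph (\<open>region_is_epigraph_near\<close>).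

  Scale the disk of radius \<open>r\<close> to the unit disk. The graph becomes that of
  \<open>u \<mapsto> f (r u) / r\<close>, and by Cavalieri's principle \<open>g(s,r) / r\<^sup>2\<close> is the integral over
  \<open>u \<in> [-1, 1]\<close> of the length of the part of the vertical chord above that graph
  (\<open>area_of_epigraph_in_disk\<close>). The \<open>r\<close>-derivative of \<open>f (r u) / r\<close> is \<open>u\<^sup>2 k(r u)\<close>, where
  \<open>k(a) = (a f'(a) - f(a)) / a\<^sup>2\<close> tends to \<open>\<kappa> / 2\<close> as \<open>a \<rightarrow> 0\<close>. Dominated convergence
  therefore shows both that \<open>g(s,r) / r\<^sup>2\<close> is differentiable for small \<open>r > 0\<close>
  (\<open>area_above_graph_deriv\<close>) and that its derivative tends to
  \<open>- (\<kappa> / 2) \<integral> u\<^sup>2 du = - \<kappa> / 3\<close> (\<open>area_above_graph_deriv_limit\<close>). Dividing by \<open>\<pi>\<close> gives the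
  formula. Because the limit only sees small radii, two regions with the same areas for
  \<open>r < \<epsilon>\<close> have the same curvature.
\<close>

section \<open>Limits of integrals depending on a real parameter\<close>

text \<open>
  The convergence theorem is used for a real parameter, once at an interior point (difference
  quotients) and once at an endpoint (the limit of the derivative), so the limit is taken along
  \<open>at r0 within S\<close>. For the difference quotients, the exceptional set \<open>N\<close> consists of the
  abscissae where the graph meets the circle; there the integrand may have a corner as a function of
  the parameter.
\<close>

lemma tendsto_integral_dominated:
  fixes F :: "real \<Rightarrow> real \<Rightarrow> real"
  assumes N: "finite N" and lim: "r0 islimpt S"
    and int: "\<And>r. r \<in> S \<Longrightarrow> F r integrable_on {a..b}"
    and bound: "\<And>r u. r \<in> S \<Longrightarrow> u \<in> {a..b} - N \<Longrightarrow> \<bar>F r u\<bar> \<le> C"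
    and conv: "\<And>u. u \<in> {a..b} - N \<Longrightarrow> ((\<lambda>r. F r u) \<longlongrightarrow> G u) (at r0 within S)"
  shows "G integrable_on {a..b}"
    and "((\<lambda>r. integral {a..b} (F r)) \<longlongrightarrow> integral {a..b} G) (at r0 within S)"
proof -
  define F' where "F' r u = (if u \<in> N then 0 else F r u)" for r u
  define G' where "G' u = (if u \<in> N then 0 else G u)" for u
  have F': "F' r integrable_on {a..b}" "integral {a..b} (F' r) = integral {a..b} (F r)" if "r \<in> S" for r
    using integrable_spike_finite[OF N _ int[OF that], of "F' r"]
      integral_spike[OF negligible_finite[OF N], of "{a..b}" "F' r" "F r"]
    by (auto simp: F'_def)
  have seq: "G' integrable_on {a..b}"
    "(\<lambda>k. integral {a..b} (F' (X k))) \<longlonglongrightarrow> integral {a..b} G'"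
    if X: "\<And>k. X k \<in> S - {r0}" and X0: "X \<longlonglongrightarrow> r0" for X :: "nat \<Rightarrow> real"
  proof -
    have 1: "F' (X k) integrable_on {a..b}" for k using F' X by blast
    have 2: "(\<lambda>_. \<bar>C\<bar>) integrable_on {a..b}" by (rule integrable_const_ivl)
    have 3: "norm (F' (X k) u) \<le> \<bar>C\<bar>" if "u \<in> {a..b}" for k u
      using bound[of "X k" u] X[of k] that by (auto simp: F'_def)
    have 4: "(\<lambda>k. F' (X k) u) \<longlonglongrightarrow> G' u" if "u \<in> {a..b}" for u
    proof (cases "u \<in> N")
      case False
      with conv[of u] that have "((\<lambda>r. F r u) \<longlongrightarrow> G u) (at r0 within S)" by simp
      then have "((\<lambda>r. F r u) \<circ> X) \<longlonglongrightarrow> G u"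
        using X X0 unfolding tendsto_at_iff_sequentially by blast
      with False show ?thesis by (simp add: F'_def G'_def o_def)
    qed (simp add: F'_def G'_def)
    show "G' integrable_on {a..b}"
      "(\<lambda>k. integral {a..b} (F' (X k))) \<longlonglongrightarrow> integral {a..b} G'"
      using dominated_convergence[of "\<lambda>k. F' (X k)", OF 1 2 3 4] by blast+
  qed
  obtain X where "\<And>k. X k \<in> S - {r0}" "X \<longlonglongrightarrow> r0"
    using lim unfolding islimpt_sequential by auto
  from seq(1)[OF this] have "G' integrable_on {a..b}" .
  then show "G integrable_on {a..b}"
    by (rule integrable_spike_finite[OF N, rotated]) (simp add: G'_def)
  have GG: "integral {a..b} G = integral {a..b} G'"
    by (rule integral_spike[OF negligible_finite[OF N]]) (simp add: G'_def)
  show "((\<lambda>r. integral {a..b} (F r)) \<longlongrightarrow> integral {a..b} G) (at r0 within S)"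
    unfolding tendsto_at_iff_sequentially GG
  proof (intro allI impI)
    fix X :: "nat \<Rightarrow> real" assume "\<forall>i. X i \<in> S - {r0}" "X \<longlonglongrightarrow> r0"
    then show "((\<lambda>r. integral {a..b} (F r)) \<circ> X) \<longlonglongrightarrow> integral {a..b} G'"
      using seq(2)[of X] F'(2) by (simp add: o_def)
  qed
qed

section \<open>The rescaled area above a graph\<close>

definition clip :: "real \<Rightarrow> real \<Rightarrow> real" where
  "clip w a = max (- w) (min w a)"

text \<open>
  Rescaling the disk of radius \<open>r\<close> about the origin to the unit disk turns the graph of \<open>f\<close> into the
  graph of \<open>u \<mapsto> f (r u) / r\<close>. The vertical chord of the unit disk at abscissa \<open>u\<close> is
  \<open>[-w, w]\<close> with \<open>w = sqrt (1 - u\<^sup>2)\<close>, and the integrand is the length of its part above the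
  rescaled graph. So \<open>r\<^sup>2\<close> times this number is the area above the graph in the disk of
  radius \<open>r\<close>.
\<close>

definition area_above_graph :: "(real \<Rightarrow> real) \<Rightarrow> real \<Rightarrow> real" where
  "area_above_graph f r =
     integral {-1..1} (\<lambda>u. sqrt (1 - u\<^sup>2) - clip (sqrt (1 - u\<^sup>2)) (f (r * u) / r))"

text \<open>
  The derivative of the chord slope \<open>a \<mapsto> f a / a\<close>. At \<open>a = 0\<close> the value is \<open>0\<close> by the
  convention for division, which is harmless because it always occurs multiplied by a power of
  the abscissa. For a \<open>C\<^sup>2\<close> graph tangent to the axis at the origin it tends to half the curvature.
\<close>

definition bend :: "(real \<Rightarrow> real) \<Rightarrow> (real \<Rightarrow> real) \<Rightarrow> real \<Rightarrow> real" where
  "bend f f' a = (a * f' a - f a) / a\<^sup>2"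

lemma clip_lipschitz: "\<bar>clip w a - clip w b\<bar> \<le> \<bar>a - b\<bar>"
  unfolding clip_def by linarith

lemma clip_simps:
  "\<bar>a\<bar> < w \<Longrightarrow> clip w a = a"
  "0 \<le> w \<Longrightarrow> w < a \<Longrightarrow> clip w a = w"
  "0 \<le> w \<Longrightarrow> a < - w \<Longrightarrow> clip w a = - w"
  unfolding clip_def by linarith+

lemma lipschitz_graph:
  fixes f :: "real \<Rightarrow> real"
  assumes deriv: "\<And>a. \<bar>a\<bar> < \<delta> \<Longrightarrow> (f has_real_derivative f' a) (at a)"
    and slope: "\<And>a. \<bar>a\<bar> < \<delta> \<Longrightarrow> \<bar>f' a\<bar> \<le> 1/2"
    and "\<bar>a\<bar> < \<delta>" "\<bar>b\<bar> < \<delta>"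
  shows "\<bar>f a - f b\<bar> \<le> 1/2 * \<bar>a - b\<bar>"
proof -
  have "norm (f a - f b) \<le> 1/2 * norm (a - b)"
  proof (rule field_differentiable_bound[of "{-\<delta><..<\<delta>}"])
    show "(f has_field_derivative f' z) (at z within {-\<delta><..<\<delta>})" "norm (f' z) \<le> 1/2"
      if "z \<in> {-\<delta><..<\<delta>}" for z
      using that has_field_derivative_at_within[OF deriv] slope[of z] by (simp_all add: abs_less_iff)
  qed (use assms(3,4) in auto)
  then show ?thesis by simp
qed

text \<open>
  A graph of slope at most \<open>1/2\<close> crosses a circle about the origin at most once on each side: two
  crossings \<open>u\<close>, \<open>v\<close> on the same side would satisfy
  \<open>\<bar>u\<^sup>2 - v\<^sup>2\<bar> = \<bar>F u ^ 2 - F v ^ 2\<bar> \<le> \<bar>u\<^sup>2 - v\<^sup>2\<bar> / 4\<close> for the rescaled graph \<open>F\<close>.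
\<close>

lemma finite_crossings:
  fixes f :: "real \<Rightarrow> real"
  assumes f0: "f 0 = 0"
    and deriv: "\<And>a. \<bar>a\<bar> < \<delta> \<Longrightarrow> (f has_real_derivative f' a) (at a)"
    and slope: "\<And>a. \<bar>a\<bar> < \<delta> \<Longrightarrow> \<bar>f' a\<bar> \<le> 1/2"
    and r: "0 < r" "r < \<delta>"
  shows "finite {u \<in> {-1..1}. \<bar>f (r * u) / r\<bar> = sqrt (1 - u\<^sup>2)}" (is "finite ?N")
proof -
  have ru: "\<bar>r * u\<bar> < \<delta>" if "\<bar>u\<bar> \<le> 1" for u
  proof -
    have "\<bar>r * u\<bar> \<le> r" using that r by (simp add: abs_mult mult_left_le abs_le_iff)
    then show ?thesis using r by simp
  qed
  have lip: "\<bar>f (r * u) / r - f (r * v) / r\<bar> \<le> 1/2 * \<bar>u - v\<bar>" if "\<bar>u\<bar> \<le> 1" "\<bar>v\<bar> \<le> 1" for u v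
  proof -
    have "\<bar>f (r * u) - f (r * v)\<bar> \<le> 1/2 * \<bar>r * u - r * v\<bar>"
      by (rule lipschitz_graph[OF deriv slope]) (use ru that in auto)
    also have "\<dots> = r * (1/2 * \<bar>u - v\<bar>)" using r by (simp flip: right_diff_distrib add: abs_mult)
    finally show ?thesis using r by (simp flip: diff_divide_distrib add: pos_divide_le_eq mult_ac)
  qed
  have uniq: "u = v" if "u \<in> ?N" "v \<in> ?N" "0 \<le> u * v" for u v
  proof (rule ccontr)
    assume "u \<noteq> v"
    define p where "p = f (r * u) / r"
    define q where "q = f (r * v) / r"
    have sq: "p\<^sup>2 = 1 - u\<^sup>2" "q\<^sup>2 = 1 - v\<^sup>2"
      using that by (auto simp: p_def q_def abs_le_square_iff abs_square_le_1
          simp flip: real_sqrt_abs)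
    have b: "\<bar>p - q\<bar> \<le> 1/2 * \<bar>u - v\<bar>" "\<bar>p\<bar> \<le> 1/2 * \<bar>u\<bar>" "\<bar>q\<bar> \<le> 1/2 * \<bar>v\<bar>"
    proof -
      have "\<bar>u\<bar> \<le> 1" "\<bar>v\<bar> \<le> 1" using that(1,2) by auto
      then show "\<bar>p - q\<bar> \<le> 1/2 * \<bar>u - v\<bar>" "\<bar>p\<bar> \<le> 1/2 * \<bar>u\<bar>" "\<bar>q\<bar> \<le> 1/2 * \<bar>v\<bar>"
        using lip[of u v] lip[of u 0] lip[of v 0] unfolding p_def q_def by (simp_all only: f0 mult_zero_right div_0 diff_zero abs_zero zero_le_one)
    qed
    have same: "\<bar>u\<bar> + \<bar>v\<bar> = \<bar>u + v\<bar>" using that(3) by (auto simp: zero_le_mult_iff)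
    have pos: "0 < \<bar>u - v\<bar> * \<bar>u + v\<bar>" using same \<open>u \<noteq> v\<close> by auto
    have "\<bar>u - v\<bar> * \<bar>u + v\<bar> = \<bar>p - q\<bar> * \<bar>p + q\<bar>"
    proof -
      have "(u - v) * (u + v) = - ((p - q) * (p + q))"
        using sq by (simp add: power2_eq_square algebra_simps)
      then show ?thesis by (metis abs_minus_cancel abs_mult)
    qed
    also have "\<dots> \<le> (1/2 * \<bar>u - v\<bar>) * (1/2 * \<bar>u + v\<bar>)"
    proof (rule mult_mono)
      show "\<bar>p + q\<bar> \<le> 1/2 * \<bar>u + v\<bar>" using b(2,3) same by argo
    qed (use b(1) in simp_all)
    finally show False using pos by simp
  qed
  have one: "finite M" if "M \<subseteq> ?N" "\<And>u v. u \<in> M \<Longrightarrow> v \<in> M \<Longrightarrow> 0 \<le> u * v" for M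
  proof (cases "M = {}")
    case False
    then obtain v where "v \<in> M" by blast
    with uniq that have "M \<subseteq> {v}" by blast
    then show ?thesis by (rule finite_subset) simp
  qed simp
  have "finite (?N \<inter> {0..})" by (rule one) auto
  moreover have "finite (?N \<inter> {..0})" by (rule one) (auto intro: mult_nonpos_nonpos)
  moreover have "?N \<subseteq> (?N \<inter> {0..}) \<union> (?N \<inter> {..0})" by auto
  ultimately show ?thesis by (meson finite_UnI finite_subset)
qed

lemma DERIV_rescaled_graph:
  fixes f :: "real \<Rightarrow> real"
  assumes f0: "f 0 = 0" and "r \<noteq> 0" and d: "(f has_real_derivative f' (r * u)) (at (r * u))"
  shows "((\<lambda>r. f (r * u) / r) has_real_derivative u\<^sup>2 * bend f f' (r * u)) (at r)"
proof -
  have 1: "((\<lambda>r. r * u) has_real_derivative u) (at r)"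
    by (auto intro!: derivative_eq_intros)
  have "((\<lambda>r. f (r * u)) has_real_derivative f' (r * u) * u) (at r)"
    by (rule DERIV_chain2[of f "f' (r * u)" "\<lambda>r. r * u" r u UNIV, OF d 1])
  from DERIV_divide[OF this DERIV_ident \<open>r \<noteq> 0\<close>]
  have 2: "((\<lambda>r. f (r * u) / r) has_real_derivative (f' (r * u) * u * r - f (r * u) * 1) / (r * r)) (at r)" .
  have 3: "(f' (r * u) * u * r - f (r * u) * 1) / (r * r) = u\<^sup>2 * bend f f' (r * u)"
    using \<open>r \<noteq> 0\<close> f0 by (cases "u = 0") (simp_all add: bend_def power2_eq_square)
  show ?thesis using 2 unfolding 3 .
qed

lemma area_above_graph_integrable:
  fixes f :: "real \<Rightarrow> real"
  assumes deriv: "\<And>a. \<bar>a\<bar> < \<delta> \<Longrightarrow> (f has_real_derivative f' a) (at a)"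
    and r: "0 < r" "r < \<delta>"
  shows "(\<lambda>u. sqrt (1 - u\<^sup>2) - clip (sqrt (1 - u\<^sup>2)) (f (r * u) / r)) integrable_on {-1..1}"
proof -
  have "continuous_on {-\<delta><..<\<delta>} f"
    by (rule DERIV_continuous_on[where D=f'], rule has_field_derivative_at_within, rule deriv)
      (simp add: abs_less_iff)
  then have "continuous_on {-1..1} (\<lambda>u. f (r * u))"
  proof (rule continuous_on_compose2)
    show "(\<lambda>u. r * u) ` {- 1..1} \<subseteq> {- \<delta><..<\<delta>}"
    proof clarify
      fix u :: real assume "u \<in> {-1..1}"
      then have "\<bar>r * u\<bar> \<le> r" using r by (simp add: abs_mult mult_left_le abs_le_iff)
      then have "\<bar>r * u\<bar> < \<delta>" using r by simp
      then show "r * u \<in> {- \<delta><..<\<delta>}" by (simp add: abs_less_iff)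
    qed
  qed (intro continuous_intros)
  then show ?thesis unfolding clip_def using r
    by (intro integrable_continuous_real continuous_intros) auto
qed

text \<open>
  Differentiation under the integral sign. Where the rescaled graph is strictly inside the disk,
  the chord length has derivative minus that of \<open>f (r u) / r\<close>; where it is strictly outside, the
  chord length is locally constant; and the finitely many crossings form a null set. The difference
  quotients are dominated by the bound on \<open>bend\<close>, since clipping is 1-Lipschitz. Working with the
  unit disk avoids differentiating \<open>sqrt (r\<^sup>2 - x\<^sup>2)\<close> in \<open>r\<close>, which is singular at the ends of the
  interval.
\<close>

lemma area_above_graph_deriv:
  fixes f :: "real \<Rightarrow> real"
  assumes f0: "f 0 = 0"
    and deriv: "\<And>a. \<bar>a\<bar> < \<delta> \<Longrightarrow> (f has_real_derivative f' a) (at a)"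
    and slope: "\<And>a. \<bar>a\<bar> < \<delta> \<Longrightarrow> \<bar>f' a\<bar> \<le> 1/2"
    and bend: "\<And>a. \<bar>a\<bar> < \<delta> \<Longrightarrow> \<bar>bend f f' a\<bar> \<le> C"
    and r: "0 < r" "r < \<delta>"
  defines "D \<equiv> \<lambda>r u. if \<bar>f (r * u) / r\<bar> < sqrt (1 - u\<^sup>2) then - (u\<^sup>2 * bend f f' (r * u)) else 0"
  shows "D r integrable_on {-1..1}"
    and "(area_above_graph f has_real_derivative integral {-1..1} (D r)) (at r)"
proof -
  define A where "A r u = sqrt (1 - u\<^sup>2) - clip (sqrt (1 - u\<^sup>2)) (f (r * u) / r)" for r u
  define Q where "Q y u = (A y u - A r u) / (y - r)" for y u
  have in_dom: "\<bar>y * u\<bar> < \<delta>" if "y \<in> {0<..<\<delta>}" "u \<in> {-1..1}" for y u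
  proof -
    have "\<bar>y * u\<bar> \<le> y" using that by (simp add: abs_mult mult_left_le abs_le_iff)
    then show ?thesis using that by simp
  qed
  have dF: "((\<lambda>r. f (r * u) / r) has_real_derivative u\<^sup>2 * bend f f' (y * u)) (at y)"
    if "y \<in> {0<..<\<delta>}" "u \<in> {-1..1}" for y u
    using that by (intro DERIV_rescaled_graph f0 deriv in_dom) auto
  have A_int: "A y integrable_on {-1..1}" if "y \<in> {0<..<\<delta>}" for y
    unfolding A_def using that by (intro area_above_graph_integrable[OF deriv]) auto
  have Q_int: "Q y integrable_on {-1..1}" if "y \<in> {0<..<\<delta>}" for y
    unfolding Q_def using A_int[OF that] A_int[of r] r
    by (intro integrable_on_divide integrable_diff) auto
  have C0: "0 \<le> C" using bend[of 0] r by simp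
  have Q_bound: "\<bar>Q y u\<bar> \<le> C" if y: "y \<in> {0<..<\<delta>}" and u: "u \<in> {-1..1}" for y u
  proof -
    have sb: "norm (u\<^sup>2 * bend f f' (z * u)) \<le> C" if "z \<in> {0<..<\<delta>}" for z
    proof -
      have "u\<^sup>2 \<le> 1" using u by (simp add: abs_square_le_1 abs_le_iff)
      then have "u\<^sup>2 * \<bar>bend f f' (z * u)\<bar> \<le> 1 * C"
        using bend[OF in_dom[OF that u]] by (rule mult_mono) simp_all
      then show ?thesis by (simp add: abs_mult)
    qed
    have "norm (f (y * u) / y - f (r * u) / r) \<le> C * norm (y - r)"
    proof (rule field_differentiable_bound[of "{0<..<\<delta>}"
            "\<lambda>z. f (z * u) / z" "\<lambda>z. u\<^sup>2 * bend f f' (z * u)"])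
      show "((\<lambda>z. f (z * u) / z) has_field_derivative u\<^sup>2 * bend f f' (z * u)) (at z within {0<..<\<delta>})"
        if "z \<in> {0<..<\<delta>}" for z
        by (rule has_field_derivative_at_within, rule dF[OF that u])
    qed (use y r sb in simp_all)
    moreover have "\<bar>A y u - A r u\<bar> \<le> \<bar>f (y * u) / y - f (r * u) / r\<bar>"
      using clip_lipschitz[of "sqrt (1 - u\<^sup>2)" "f (y * u) / y" "f (r * u) / r"] by (simp add: A_def)
    ultimately have "\<bar>A y u - A r u\<bar> \<le> C * \<bar>y - r\<bar>" by simp
    then show ?thesis using C0 by (cases "y = r") (auto simp: Q_def pos_divide_le_eq)
  qed
  define N where "N = {u \<in> {-1..1}. \<bar>f (r * u) / r\<bar> = sqrt (1 - u\<^sup>2)}"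
  have N: "finite N" unfolding N_def by (rule finite_crossings[OF f0 deriv slope r])
  have Q_lim: "((\<lambda>y. Q y u) \<longlongrightarrow> D r u) (at r within {0<..<\<delta>})" if u: "u \<in> {-1..1} - N" for u
  proof -
    define w where "w = sqrt (1 - u\<^sup>2)"
    have w: "0 \<le> w" using u by (simp add: w_def abs_square_le_1 abs_le_iff)
    have d: "((\<lambda>r. f (r * u) / r) has_real_derivative u\<^sup>2 * bend f f' (r * u)) (at r)"
      by (rule dF) (use u r in simp_all)
    then have lim: "((\<lambda>r. f (r * u) / r) \<longlongrightarrow> f (r * u) / r) (at r)"
      by (rule DERIV_isCont[unfolded isCont_def])
    have "((\<lambda>y. A y u) has_real_derivative D r u) (at r)"
    proof (cases "\<bar>f (r * u) / r\<bar> < w")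
      case True
      have "\<forall>\<^sub>F y in at r. \<bar>f (y * u) / y\<bar> < w"
        by (rule order_tendstoD(2)[OF tendsto_rabs[OF lim] True])
      then have ev: "\<forall>\<^sub>F y in nhds r. A y u = w - f (y * u) / y"
        using True unfolding eventually_nhds_conv_at A_def w_def[symmetric]
        by (auto simp only: clip_simps elim!: eventually_mono)
      have "((\<lambda>y. w - f (y * u) / y) has_real_derivative D r u) (at r)"
        using DERIV_diff[OF DERIV_const[of w] d] True by (simp add: D_def w_def)
      then show ?thesis using ev by (subst DERIV_cong_ev[OF refl _ refl])
    next
      case False
      with u have gt: "\<bar>f (r * u) / r\<bar> > w" by (auto simp: N_def w_def)
      have D0: "D r u = 0" using False by (simp add: D_def w_def)
      consider "f (r * u) / r > w" | "f (r * u) / r < - w" using gt by linarith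
      then obtain c where "\<forall>\<^sub>F y in nhds r. A y u = c"
      proof cases
        case 1
        have "\<forall>\<^sub>F y in at r. f (y * u) / y > w" by (rule order_tendstoD(1)[OF lim 1])
        then have "\<forall>\<^sub>F y in nhds r. A y u = 0"
          using 1 w unfolding eventually_nhds_conv_at A_def w_def[symmetric]
          by (auto simp: clip_simps elim!: eventually_mono)
        then show ?thesis by (rule that)
      next
        case 2
        have "\<forall>\<^sub>F y in at r. f (y * u) / y < - w" by (rule order_tendstoD(2)[OF lim 2])
        then have "\<forall>\<^sub>F y in nhds r. A y u = 2 * w"
          using 2 w unfolding eventually_nhds_conv_at A_def w_def[symmetric]
          by (auto simp: clip_simps elim!: eventually_mono)
        then show ?thesis by (rule that)
      qed
      then show ?thesis unfolding D0 by (subst DERIV_cong_ev[OF refl _ refl]) auto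
    qed
    then show ?thesis
      unfolding has_field_derivative_iff Q_def by (rule tendsto_within_subset) simp
  qed
  have isl: "r islimpt {0<..<\<delta>}" using r by (simp add: interior_limit_point)
  have Q: "\<And>y u. y \<in> {0<..<\<delta>} \<Longrightarrow> u \<in> {-1..1} - N \<Longrightarrow> \<bar>Q y u\<bar> \<le> C"
    using Q_bound by blast
  show "D r integrable_on {-1..1}"
    by (rule tendsto_integral_dominated(1)[OF N isl Q_int Q Q_lim])
  have "((\<lambda>y. integral {-1..1} (Q y)) \<longlongrightarrow> integral {-1..1} (D r)) (at r within {0<..<\<delta>})"
    by (rule tendsto_integral_dominated(2)[OF N isl Q_int Q Q_lim])
  moreover have "\<forall>\<^sub>F y in at r within {0<..<\<delta>}. integral {-1..1} (Q y) =
      (area_above_graph f y - area_above_graph f r) / (y - r)"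
    unfolding eventually_at_filter
  proof (intro always_eventually allI impI)
    fix y assume "y \<in> {0<..<\<delta>}"
    then show "integral {-1..1} (Q y) = (area_above_graph f y - area_above_graph f r) / (y - r)"
      unfolding Q_def area_above_graph_def A_def[symmetric]
      using A_int[of y] A_int[of r] r by (simp add: integral_diff)
  qed
  ultimately have "((\<lambda>y. (area_above_graph f y - area_above_graph f r) / (y - r))
      \<longlongrightarrow> integral {-1..1} (D r)) (at r within {0<..<\<delta>})"
    by (rule Lim_transform_eventually)
  moreover have "at r within {0<..<\<delta>} = at r" using r by (intro at_within_open) auto
  ultimately show "(area_above_graph f has_real_derivative integral {-1..1} (D r)) (at r)"
    by (simp add: has_field_derivative_iff)
qed

text \<open>
  For small radii the rescaled graph is inside the disk at every \<open>\<bar>u\<bar> < 1\<close>, so the derivative tends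
  to the integral of \<open>- u\<^sup>2 \<kappa> / 2\<close> over \<open>[-1, 1]\<close>. This second moment of the interval is the source
  of the factor 3 in the curvature formula.
\<close>

lemma area_above_graph_deriv_limit:
  fixes f :: "real \<Rightarrow> real"
  assumes f0: "f 0 = 0" and \<delta>: "0 < \<delta>"
    and deriv: "\<And>a. \<bar>a\<bar> < \<delta> \<Longrightarrow> (f has_real_derivative f' a) (at a)"
    and slope: "\<And>a. \<bar>a\<bar> < \<delta> \<Longrightarrow> \<bar>f' a\<bar> \<le> 1/2"
    and bend: "\<And>a. \<bar>a\<bar> < \<delta> \<Longrightarrow> \<bar>bend f f' a\<bar> \<le> C"
    and f'0: "f' 0 = 0"
    and lim: "(bend f f' \<longlongrightarrow> \<kappa> / 2) (at 0)"
  obtains G where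
    "\<And>r. 0 < r \<Longrightarrow> r < \<delta> \<Longrightarrow> (area_above_graph f has_real_derivative G r) (at r)"
    "(G \<longlongrightarrow> - \<kappa> / 3) (at_right 0)"
proof -
  define D where "D r u =
    (if \<bar>f (r * u) / r\<bar> < sqrt (1 - u\<^sup>2) then - (u\<^sup>2 * bend f f' (r * u)) else 0)" for r u
  note der = area_above_graph_deriv[OF f0 deriv slope bend, folded D_def]
  have lim': "((\<lambda>r. integral {-1..1} (D r)) \<longlongrightarrow> integral {-1..1} (\<lambda>u. - (u\<^sup>2 * (\<kappa> / 2))))
      (at 0 within {0<..<\<delta>})"
  proof (rule tendsto_integral_dominated(2))
    \<comment> \<open>At \<open>\<plusminus>1\<close> the chord degenerates; at 0 the map \<open>r \<mapsto> r u\<close> is constant, so limits at 0 do not compose.\<close>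
    show "finite {-1, 0, 1 :: real}" by simp
    show "0 islimpt {0<..<\<delta>}" using \<delta> by (simp add: islimpt_greaterThanLessThan1)
    show "D r integrable_on {-1..1}" if "r \<in> {0<..<\<delta>}" for r using der(1) that by auto
    show "\<bar>D r u\<bar> \<le> C" if "r \<in> {0<..<\<delta>}" "u \<in> {-1..1} - {-1, 0, 1}" for r u
    proof -
      have "u\<^sup>2 \<le> 1" using that by (simp add: abs_square_le_1 abs_le_iff)
      moreover have "\<bar>r * u\<bar> \<le> r" using that by (simp add: abs_mult mult_left_le abs_le_iff)
      then have "\<bar>bend f f' (r * u)\<bar> \<le> C" using that by (intro bend) auto
      ultimately have "u\<^sup>2 * \<bar>bend f f' (r * u)\<bar> \<le> 1 * C"
        by (rule mult_mono) simp_all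
      moreover have "0 \<le> C" using bend[of 0] \<delta> by simp
      ultimately show ?thesis by (simp add: D_def abs_mult)
    qed
    show "((\<lambda>r. D r u) \<longlongrightarrow> - (u\<^sup>2 * (\<kappa> / 2))) (at 0 within {0<..<\<delta>})"
      if u: "u \<in> {-1..1} - {-1, 0, 1}" for u
    proof -
      have w: "0 < sqrt (1 - u\<^sup>2)" using u by (auto simp: abs_square_less_1)
      have "u \<noteq> 0" using u by simp
      then have fl: "filterlim (\<lambda>r. r * u) (at 0) (at 0)"
        by (intro filterlim_atI tendsto_eq_intros eventually_neq_at_within | force simp: eventually_at_filter)+
      have k: "((\<lambda>r. - (u\<^sup>2 * bend f f' (r * u))) \<longlongrightarrow> - (u\<^sup>2 * (\<kappa> / 2))) (at 0)"
        by (intro tendsto_intros filterlim_compose[OF lim fl])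
      have "((\<lambda>a. f a / a) \<longlongrightarrow> 0) (at 0)"
        using deriv[of 0] \<delta> f0 f'0 by (simp add: has_field_derivative_iff)
      from tendsto_mult[OF filterlim_compose[OF this fl] tendsto_const[of u]]
      have "((\<lambda>r. f (r * u) / r) \<longlongrightarrow> 0) (at 0)" using \<open>u \<noteq> 0\<close> by simp
      from order_tendstoD(2)[OF tendsto_rabs[OF this], of "sqrt (1 - u\<^sup>2)"]
      have "\<forall>\<^sub>F r in at 0. \<bar>f (r * u) / r\<bar> < sqrt (1 - u\<^sup>2)" using w by simp
      then have "\<forall>\<^sub>F r in at 0. - (u\<^sup>2 * bend f f' (r * u)) = D r u"
        by eventually_elim (auto simp: D_def)
      from Lim_transform_eventually[OF k this] show ?thesis
        by (rule tendsto_mono[OF at_le, rotated]) simp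
    qed
  qed
  have "((\<lambda>u. - (u\<^sup>2 * (\<kappa> / 2))) has_integral (- (1 ^ 3 * (\<kappa> / 6)) - - ((-1) ^ 3 * (\<kappa> / 6)))) {-1..1}"
    by (rule fundamental_theorem_of_calculus)
      (auto intro!: derivative_eq_intros simp flip: has_real_derivative_iff_has_vector_derivative)
  moreover have "- (1 ^ 3 * (\<kappa> / 6)) - - ((-1) ^ 3 * (\<kappa> / 6)) = - \<kappa> / 3" by simp
  ultimately have moment: "integral {-1..1} (\<lambda>u. - (u\<^sup>2 * (\<kappa> / 2))) = - \<kappa> / 3"
    by (metis integral_unique)
  have "((\<lambda>r. integral {-1..1} (D r)) \<longlongrightarrow> - \<kappa> / 3) (at 0 within {0<..<\<delta>})"
    using lim' unfolding moment .
  moreover have "at 0 within {0<..<\<delta>} = at_right 0"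
    by (rule at_within_nhd[of _ "{..<\<delta>}"]) (use \<delta> in auto)
  ultimately have "((\<lambda>r. integral {-1..1} (D r)) \<longlongrightarrow> - \<kappa> / 3) (at_right 0)" by metis
  with der(2) show thesis by (intro that) blast+
qed

section \<open>A regular curve as a graph over its tangent\<close>

text \<open>
  The quantity is \<open>bend f f'\<close> at \<open>x t\<close> if the curve \<open>(x, y)\<close> is the graph of \<open>f\<close>. As \<open>x\<close> is
  asymptotic to \<open>t\<close>, \<open>y'\<close> to \<open>\<kappa> t\<close> and \<open>y\<close> to \<open>\<kappa> t\<^sup>2 / 2\<close>, the limit is \<open>\<kappa> - \<kappa> / 2\<close>.
\<close>

lemma bend_limit:
  fixes x y x' y' :: "real \<Rightarrow> real"
  assumes dx: "\<And>t. (x has_real_derivative x' t) (at t)"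
    and dy: "\<And>t. (y has_real_derivative y' t) (at t)"
    and 0: "x 0 = 0" "y 0 = 0" "x' 0 = 1" "y' 0 = 0"
    and cont: "isCont x' 0"
    and d2y: "(y' has_real_derivative \<kappa>) (at 0)"
  shows "((\<lambda>t. (x t * (y' t / x' t) - y t) / (x t)\<^sup>2) \<longlongrightarrow> \<kappa> / 2) (at 0)"
proof -
  have x1: "((\<lambda>t. x t / t) \<longlongrightarrow> 1) (at 0)"
    using dx[of 0] 0 by (simp add: has_field_derivative_iff)
  have y'1: "((\<lambda>t. y' t / t) \<longlongrightarrow> \<kappa>) (at 0)"
    using d2y 0 by (simp add: has_field_derivative_iff)
  have x'1: "(x' \<longlongrightarrow> 1) (at 0)" using cont 0 by (simp add: isCont_def)
  have y2: "((\<lambda>t. y t / t\<^sup>2) \<longlongrightarrow> \<kappa> / 2) (at 0)"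
  proof (rule lhopital[where f' = y' and g' = "\<lambda>t. 2 * t"])
    show "(y \<longlongrightarrow> 0) (at 0)" using DERIV_isCont[OF dy[of 0]] 0 by (simp add: isCont_def)
    show "((\<lambda>t::real. t\<^sup>2) \<longlongrightarrow> 0) (at 0)" by (auto intro!: tendsto_eq_intros)
    show "\<forall>\<^sub>F t::real in at 0. t\<^sup>2 \<noteq> 0" "\<forall>\<^sub>F t::real in at 0. 2 * t \<noteq> 0"
      by (auto simp: eventually_at_filter)
    show "\<forall>\<^sub>F t in at 0. (y has_real_derivative y' t) (at t)" using dy by simp
    show "\<forall>\<^sub>F t::real in at 0. ((\<lambda>t. t\<^sup>2) has_real_derivative 2 * t) (at t)"
      by (intro always_eventually allI) (auto intro!: derivative_eq_intros)
    from tendsto_divide[OF y'1 tendsto_const[of 2]]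
    show "((\<lambda>t. y' t / (2 * t)) \<longlongrightarrow> \<kappa> / 2) (at 0)" by (simp add: mult_ac)
  qed
  have "((\<lambda>t. (x t / t * (y' t / t / x' t) - y t / t\<^sup>2) / (x t / t)\<^sup>2) \<longlongrightarrow>
      (1 * (\<kappa> / 1) - \<kappa> / 2) / 1\<^sup>2) (at 0)"
    by (intro tendsto_intros x1 y'1 x'1 y2) simp_all
  moreover have "\<forall>\<^sub>F t in at 0. (x t / t * (y' t / t / x' t) - y t / t\<^sup>2) / (x t / t)\<^sup>2 =
      (x t * (y' t / x' t) - y t) / (x t)\<^sup>2"
    unfolding eventually_at_filter
  proof (intro always_eventually allI impI)
    fix t :: real assume "t \<noteq> 0"
    then have "x t / t * (y' t / t / x' t) - y t / t\<^sup>2 = (x t * (y' t / x' t) - y t) / t\<^sup>2"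
      by (simp add: power2_eq_square diff_divide_distrib)
    then show "(x t / t * (y' t / t / x' t) - y t / t\<^sup>2) / (x t / t)\<^sup>2 =
      (x t * (y' t / x' t) - y t) / (x t)\<^sup>2"
      using \<open>t \<noteq> 0\<close> by (simp add: power_divide)
  qed
  ultimately show ?thesis by (simp add: Lim_transform_eventually)
qed

text \<open>
  Near the parameter 0 the abscissa is strictly increasing; \<open>f\<close> is the ordinate composed with the
  inverse of the abscissa. Only the parameters in \<open>[-\<eta>, \<eta>]\<close> are covered, so the curve may come back
  over the same abscissa later.
\<close>

lemma curve_is_graph:
  fixes x y x' y' :: "real \<Rightarrow> real"
  assumes dx: "\<And>t. (x has_real_derivative x' t) (at t)"
    and dy: "\<And>t. (y has_real_derivative y' t) (at t)"
    and 0: "x 0 = 0" "y 0 = 0" "x' 0 = 1" "y' 0 = 0"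
    and cont: "isCont x' 0"
    and d2y: "(y' has_real_derivative \<kappa>) (at 0)"
  obtains \<eta> \<delta> C f f' where "0 < \<eta>" "0 < \<delta>" "f 0 = 0" "f' 0 = 0"
    "\<And>t. \<bar>t\<bar> \<le> \<eta> \<Longrightarrow> y t = f (x t)"
    "\<And>a. \<bar>a\<bar> < \<delta> \<Longrightarrow> (f has_real_derivative f' a) (at a)"
    "\<And>a. \<bar>a\<bar> < \<delta> \<Longrightarrow> \<bar>f' a\<bar> \<le> 1/2"
    "\<And>a. \<bar>a\<bar> < \<delta> \<Longrightarrow> \<bar>bend f f' a\<bar> \<le> C"
    "(bend f f' \<longlongrightarrow> \<kappa> / 2) (at 0)"
proof -
  have "(x' \<longlongrightarrow> 1) (nhds 0)" "(y' \<longlongrightarrow> 0) (nhds 0)"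
    using cont DERIV_isCont[OF d2y] tendsto_at_iff_tendsto_nhds[of x' 0]
      tendsto_at_iff_tendsto_nhds[of y' 0] 0 by (simp_all add: isCont_def)
  \<comment> \<open>These bounds keep the slope \<open>y' / x'\<close> below \<open>1/2\<close>.\<close>
  then have "\<forall>\<^sub>F t in nhds 0. 3/4 < x' t \<and> \<bar>y' t\<bar> < 1/4"
    by (intro eventually_conj order_tendstoD[where y=1] order_tendstoD(2)[where y=0] tendsto_rabs_zero) simp_all
  then obtain e where e: "0 < e" "\<And>t. \<bar>t\<bar> < e \<Longrightarrow> 3/4 < x' t \<and> \<bar>y' t\<bar> < 1/4"
    by (auto simp: eventually_nhds_metric dist_real_def)
  define \<eta> where "\<eta> = e / 2"
  have \<eta>: "0 < \<eta>" "\<And>t. \<bar>t\<bar> \<le> \<eta> \<Longrightarrow> 3/4 < x' t \<and> \<bar>y' t\<bar> < 1/4"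
    using e by (auto simp: \<eta>_def)
  have mono: "x s < x t" if "- \<eta> \<le> s" "s < t" "t \<le> \<eta>" for s t
  proof (rule DERIV_pos_imp_increasing[OF that(2)])
    fix u assume "s \<le> u" "u \<le> t"
    then have "\<bar>u\<bar> \<le> \<eta>" using that by simp
    from \<eta>(2)[OF this] dx[of u] show "\<exists>y. (x has_real_derivative y) (at u) \<and> 0 < y" by force
  qed
  define X where "X = inv_into {- \<eta>..\<eta>} x"
  have inj: "inj_on x {- \<eta>..\<eta>}"
    by (rule linorder_inj_onI) (use mono in force)+
  have Xx: "X (x t) = t" if "\<bar>t\<bar> \<le> \<eta>" for t
    unfolding X_def using that by (intro inv_into_f_f inj) (simp add: abs_le_iff)
  \<comment> \<open>The abscissae \<open>\<bar>a\<bar> < \<delta>1\<close> are all attained in the open parameter interval.\<close>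
  define \<delta>1 where "\<delta>1 = min (x \<eta>) (- x (- \<eta>))"
  have \<delta>1: "0 < \<delta>1" using mono[of 0 \<eta>] mono[of "-\<eta>" 0] \<eta>(1) 0 by (simp add: \<delta>1_def)
  have surj: "\<exists>t. \<bar>t\<bar> < \<eta> \<and> x t = a" if a: "\<bar>a\<bar> < \<delta>1" for a
  proof -
    have "x (- \<eta>) < a" "a < x \<eta>" using a by (auto simp: \<delta>1_def)
    then obtain t where t: "- \<eta> \<le> t" "t \<le> \<eta>" "x t = a"
      using IVT'[of x "- \<eta>" a \<eta>] \<eta>(1) dx
      by (metis DERIV_isCont continuous_at_imp_continuous_on less_imp_le neg_le_0_iff_le order_trans)
    then have "t \<noteq> \<eta>" "t \<noteq> - \<eta>" using \<open>x (- \<eta>) < a\<close> \<open>a < x \<eta>\<close> by auto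
    with t show ?thesis by (intro exI[of _ t]) (simp add: abs_less_iff)
  qed
  have X: "\<bar>X a\<bar> < \<eta>" "x (X a) = a" if "\<bar>a\<bar> < \<delta>1" for a
    using surj[OF that] Xx by (metis less_imp_le)+
  have X0: "X 0 = 0" using Xx[of 0] 0 \<eta>(1) by simp
  have contX: "isCont X a" if a: "\<bar>a\<bar> < \<delta>1" for a
  proof -
    have "isCont X (x (X a))"
    proof (rule isCont_inverse_function2[where f = x and x = "X a" and a = "- \<eta>" and b = \<eta>])
      show "- \<eta> < X a" "X a < \<eta>" using X(1)[OF a] by (simp_all add: abs_less_iff)
      show "X (x t) = t" if "- \<eta> \<le> t" "t \<le> \<eta>" for t
        by (rule Xx) (use that in \<open>simp add: abs_le_iff\<close>)
      show "isCont x t" for t by (rule DERIV_isCont[OF dx])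
    qed
    then show ?thesis using X(2)[OF a] by simp
  qed
  have dX: "(X has_real_derivative inverse (x' (X a))) (at a)" if a: "\<bar>a\<bar> < \<delta>1" for a
  proof (rule DERIV_inverse_function[OF dx])
    show "x' (X a) \<noteq> 0" using \<eta>(2)[of "X a"] X(1)[OF a] by force
    show "- \<delta>1 < a" "a < \<delta>1" using a by auto
    show "x (X b) = b" if "- \<delta>1 < b" "b < \<delta>1" for b using that by (intro X(2)) auto
    show "isCont X a" by (rule contX[OF a])
  qed
  define f where "f a = y (X a)" for a
  define f' where "f' a = y' (X a) / x' (X a)" for a
  have df: "(f has_real_derivative f' a) (at a)" if a: "\<bar>a\<bar> < \<delta>1" for a
    using DERIV_chain2[OF dy dX[OF a]] by (simp add: f_def[abs_def] f'_def divide_inverse)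
  have f': "\<bar>f' a\<bar> \<le> 1/2" if a: "\<bar>a\<bar> < \<delta>1" for a
  proof -
    have *: "3/4 < x' (X a)" "\<bar>y' (X a)\<bar> < 1/4" using \<eta>(2)[of "X a"] X(1)[OF a] by auto
    then have "\<bar>y' (X a)\<bar> \<le> 1/2 * \<bar>x' (X a)\<bar>" by linarith
    then show ?thesis using * by (simp add: f'_def divide_le_eq)
  qed
  have blim: "(bend f f' \<longlongrightarrow> \<kappa> / 2) (at 0)"
  proof -
    have near: "\<forall>\<^sub>F a in at 0. \<bar>a\<bar> < \<delta>1"
      using \<delta>1 by (auto simp: eventually_at dist_real_def)
    have "filterlim X (at 0) (at 0)"
    proof (rule filterlim_atI)
      show "(X \<longlongrightarrow> 0) (at 0)" using contX[of 0] \<delta>1 X0 by (simp add: isCont_def)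
      have "X a \<noteq> 0" if "a \<noteq> 0" "\<bar>a\<bar> < \<delta>1" for a using X(2)[OF that(2)] that(1) 0(1) by auto
      then show "\<forall>\<^sub>F a in at 0. X a \<noteq> 0"
        using eventually_conj[OF near eventually_neq_at_within[of 0]]
        by (auto elim!: eventually_mono)
    qed
    from filterlim_compose[OF bend_limit[OF dx dy 0 cont d2y] this]
    have "((\<lambda>a. (x (X a) * f' a - f a) / (x (X a))\<^sup>2) \<longlongrightarrow> \<kappa> / 2) (at 0)"
      by (simp add: f_def f'_def)
    moreover have "\<forall>\<^sub>F a in at 0. (x (X a) * f' a - f a) / (x (X a))\<^sup>2 = bend f f' a"
      using near by eventually_elim (simp add: X bend_def)
    ultimately show ?thesis by (rule Lim_transform_eventually)
  qed
  define C where "C = \<bar>\<kappa>\<bar> / 2 + 1"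
  have "\<forall>\<^sub>F a in at 0. \<bar>bend f f' a\<bar> < C"
    by (rule order_tendstoD(2)[OF tendsto_rabs[OF blim]]) (simp add: C_def)
  then obtain d where d: "0 < d" "\<And>a. a \<noteq> 0 \<Longrightarrow> \<bar>a\<bar> < d \<Longrightarrow> \<bar>bend f f' a\<bar> < C"
    by (auto simp: eventually_at dist_real_def)
  show thesis
  proof (rule that)
    show "0 < \<eta>" by fact
    show "0 < min \<delta>1 d" using \<delta>1 d by simp
    show "f 0 = 0" "f' 0 = 0" using X0 0 by (simp_all add: f_def f'_def)
    show "y t = f (x t)" if "\<bar>t\<bar> \<le> \<eta>" for t using Xx[OF that] by (simp add: f_def)
    show "(f has_real_derivative f' a) (at a)" "\<bar>f' a\<bar> \<le> 1/2" if "\<bar>a\<bar> < min \<delta>1 d" for a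
      using df f' that by simp_all
    show "\<bar>bend f f' a\<bar> \<le> C" if "\<bar>a\<bar> < min \<delta>1 d" for a
      using d(2)[of a] that by (cases "a = 0") (simp_all add: bend_def C_def)
    show "(bend f f' \<longlongrightarrow> \<kappa> / 2) (at 0)" by fact
  qed
qed

section \<open>The frame of tangent and left normal\<close>

definition in_frame :: "real^2 \<Rightarrow> real^2 \<Rightarrow> real \<Rightarrow> real \<Rightarrow> real^2" where
  "in_frame p T a b = p + a *\<^sub>R T + b *\<^sub>R rot90 T"

lemma rot90_orthonormal:
  assumes "norm T = 1"
  shows "T \<bullet> T = 1" "rot90 T \<bullet> rot90 T = 1" "T \<bullet> rot90 T = 0" "rot90 T \<bullet> T = 0"
proof -
  have "T \<bullet> T = 1" using assms by (simp add: dot_square_norm)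
  then show "T \<bullet> T = 1" "rot90 T \<bullet> rot90 T = 1" "T \<bullet> rot90 T = 0" "rot90 T \<bullet> T = 0"
    by (simp_all add: rot90_def inner_vec_def sum_2)
qed

lemma in_frame_coordinates:
  assumes "norm T = 1"
  shows "(in_frame p T a b - p) \<bullet> T = a" "(in_frame p T a b - p) \<bullet> rot90 T = b"
  using rot90_orthonormal[OF assms] by (simp_all add: in_frame_def inner_left_distrib)

lemma in_frame_surj:
  assumes "norm T = 1"
  shows "in_frame p T ((q - p) \<bullet> T) ((q - p) \<bullet> rot90 T) = q"
proof -
  define v where "v = q - p"
  have T: "T $ 1 * T $ 1 + T $ 2 * T $ 2 = 1"
    using rot90_orthonormal(1)[OF assms] by (simp add: inner_vec_def sum_2)
  have "v $ 1 * (T $ 1 * T $ 1 + T $ 2 * T $ 2) = v $ 1" "v $ 2 * (T $ 1 * T $ 1 + T $ 2 * T $ 2) = v $ 2"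
    unfolding T by simp_all
  then have "(v \<bullet> T) *\<^sub>R T + (v \<bullet> rot90 T) *\<^sub>R rot90 T = v"
    by (simp add: vec_eq_iff forall_2 rot90_def inner_vec_def sum_2 algebra_simps)
  then show ?thesis by (simp add: in_frame_def v_def algebra_simps)
qed

lemma dist_in_frame:
  assumes "norm T = 1"
  shows "dist (in_frame p T a b) p = sqrt (a\<^sup>2 + b\<^sup>2)"
  unfolding dist_norm norm_eq_sqrt_inner
  using rot90_orthonormal[OF assms]
  by (simp add: in_frame_def inner_left_distrib inner_right_distrib power2_eq_square)

lemma continuous_on_in_frame [continuous_intros]:
  assumes "continuous_on S g" "continuous_on S h"
  shows "continuous_on S (\<lambda>x. in_frame p T (g x) (h x))"
  unfolding in_frame_def by (intro continuous_intros assms)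

text \<open>
  Bands parallel to the graph are used instead of rectangles because they are images of rectangles,
  so that their connectedness needs no further argument.
\<close>

lemma connected_graph_strip:
  fixes f :: "real \<Rightarrow> real" and I :: "real set"
  assumes "continuous_on {-m<..<m} f" "is_interval I"
  shows "connected ((\<lambda>(a, z). in_frame p T a (f a + z)) ` ({-m<..<m} \<times> I))"
proof (rule connected_continuous_image)
  have "continuous_on ({-m<..<m} \<times> I) (\<lambda>x. f (fst x))"
    by (rule continuous_on_compose2[OF assms(1)]) (auto intro: continuous_intros)
  then show "continuous_on ({-m<..<m} \<times> I) (\<lambda>(a, z). in_frame p T a (f a + z))"
    unfolding case_prod_beta by (intro continuous_intros)
  show "connected ({-m<..<m} \<times> I)"
    using assms(2) by (intro connected_Times) (simp_all add: is_interval_connected)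
qed

section \<open>The region near a boundary point\<close>

text \<open>
  The open bands just above and just below the graph are connected and contain no boundary point,
  so each lies in \<open>\<Omega>\<close> or misses it. The upper one contains points of the inward normal
  segment. If the lower one were in \<open>\<Omega>\<close> too, then, \<open>\<Omega>\<close> being closed, so would be the graph between
  them, and \<open>p\<close> would be an interior point.
\<close>

lemma region_is_epigraph_near:
  fixes f :: "real \<Rightarrow> real"
  assumes \<Omega>: "closed \<Omega>" and p: "p \<in> frontier \<Omega>" and T: "norm T = 1"
    and \<delta>: "0 < \<delta>" and d: "0 < d"
    and cont: "continuous_on {-\<delta><..<\<delta>} f"
    and f_le: "\<And>a. \<bar>a\<bar> < \<delta> \<Longrightarrow> \<bar>f a\<bar> \<le> \<bar>a\<bar>"
    and front: "\<And>q. q \<in> frontier \<Omega> \<Longrightarrow> dist q p < d \<Longrightarrow> \<exists>a. q = in_frame p T a (f a)"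
    and left: "\<forall>\<^sub>F t in at_right 0. in_frame p T 0 t \<in> \<Omega>"
  obtains \<rho> where "0 < \<rho>" "\<rho> \<le> \<delta>"
    "\<And>a b. sqrt (a\<^sup>2 + b\<^sup>2) < \<rho> \<Longrightarrow> f a < b \<Longrightarrow> in_frame p T a b \<in> \<Omega>"
    "\<And>a b. sqrt (a\<^sup>2 + b\<^sup>2) < \<rho> \<Longrightarrow> b < f a \<Longrightarrow> in_frame p T a b \<notin> \<Omega>"
proof -
  \<comment> \<open>A point of a band of half-width \<open>m\<close> is within \<open>\<bar>a\<bar> + \<bar>f a\<bar> + \<bar>z\<bar> < 3 m\<close> of \<open>p\<close>.\<close>
  define m where "m = min \<delta> (d / 3)"
  have m: "0 < m" "m \<le> \<delta>" "3 * m \<le> d" using \<delta> d by (auto simp: m_def)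
  define strip where "strip I = (\<lambda>(a, z). in_frame p T a (f a + z)) ` ({-m<..<m} \<times> I)" for I
  have strip: "in_frame p T a b \<in> strip I" if "\<bar>a\<bar> < m" "b - f a \<in> I" for a b I
    unfolding strip_def using that
    by (intro image_eqI[of _ _ "(a, b - f a)"]) (simp_all add: abs_less_iff)
  have conn: "connected (strip I)" if "is_interval I" for I
    unfolding strip_def
    by (rule connected_graph_strip[OF continuous_on_subset[OF cont] that]) (use m in auto)
  have no_front: "strip I \<inter> frontier \<Omega> = {}" if I: "I \<subseteq> {-m<..<m} - {0}" for I
  proof (rule ccontr)
    assume "strip I \<inter> frontier \<Omega> \<noteq> {}"
    then obtain a z where q: "in_frame p T a (f a + z) \<in> frontier \<Omega>"
      and "- m < a" "a < m" and z: "z \<in> I" by (auto simp: strip_def)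
    then have a: "\<bar>a\<bar> < m" by (simp add: abs_less_iff)
    have zm: "\<bar>z\<bar> < m" "z \<noteq> 0" using z I by (auto simp: abs_less_iff)
    have "dist (in_frame p T a (f a + z)) p \<le> \<bar>a\<bar> + \<bar>f a + z\<bar>"
      unfolding dist_in_frame[OF T] by (rule sqrt_sum_squares_le_sum_abs)
    also have "\<dots> < d" using f_le[of a] a zm(1) m by linarith
    finally obtain a' where "in_frame p T a (f a + z) = in_frame p T a' (f a')"
      using front[OF q] by blast
    then show False using in_frame_coordinates[OF T] zm(2) by (metis add_cancel_right_right)
  qed
  have side: "strip I \<subseteq> \<Omega>" if "is_interval I" "I \<subseteq> {-m<..<m} - {0}" "strip I \<inter> \<Omega> \<noteq> {}" for I
    using connected_Int_frontier[OF conn[OF that(1)] that(3)] no_front[OF that(2)] by blast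
  have f0: "f 0 = 0" using f_le[of 0] \<delta> by simp
  have upper: "strip {0<..<m} \<subseteq> \<Omega>"
  proof (rule side)
    have "\<forall>\<^sub>F t in at_right 0. 0 < t \<and> t < m"
      using m(1) unfolding eventually_at_right_field by blast
    from eventually_happens[OF eventually_conj[OF this left]]
    obtain t where "0 < t" "t < m" "in_frame p T 0 t \<in> \<Omega>" by auto
    then show "strip {0<..<m} \<inter> \<Omega> \<noteq> {}" using strip[of 0 t "{0<..<m}"] f0 m(1) by auto
  qed (auto simp: is_interval_oo)
  have near: "\<bar>a\<bar> < m" "\<bar>b - f a\<bar> < m" if "sqrt (a\<^sup>2 + b\<^sup>2) < m / 2" for a b
  proof -
    have "\<bar>a\<bar> < m / 2" "\<bar>b\<bar> < m / 2"
      using that real_sqrt_ge_abs1[of a b] real_sqrt_ge_abs2[of b a] by linarith+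
    then show "\<bar>a\<bar> < m" "\<bar>b - f a\<bar> < m" using f_le[of a] m by linarith+
  qed
  have lower: "strip {-m<..<0} \<inter> \<Omega> = {}"
  proof (rule ccontr)
    assume "strip {-m<..<0} \<inter> \<Omega> \<noteq> {}"
    then have low: "strip {-m<..<0} \<subseteq> \<Omega>" by (intro side) (auto simp: is_interval_oo)
    have "ball p (m / 2) \<subseteq> \<Omega>"
    proof
      fix q assume "q \<in> ball p (m / 2)"
      define a where "a = (q - p) \<bullet> T"
      define b where "b = (q - p) \<bullet> rot90 T"
      have q: "in_frame p T a b = q" unfolding a_def b_def by (rule in_frame_surj[OF T])
      have "sqrt (a\<^sup>2 + b\<^sup>2) < m / 2"
        using \<open>q \<in> ball p (m / 2)\<close> dist_in_frame[OF T, of p a b] q by (simp add: dist_commute)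
      note ab = near[OF this]
      consider "b - f a \<in> {0<..<m}" | "b - f a \<in> {-m<..<0}" | "b = f a" using ab(2) by force
      then show "q \<in> \<Omega>"
      proof cases
        case 1 then show ?thesis using strip[OF ab(1)] upper q by blast
      next
        case 2 then show ?thesis using strip[OF ab(1)] low q by blast
      next
        case 3
        \<comment> \<open>A point on the graph is a limit of points of the upper band.\<close>
        have "((\<lambda>t. in_frame p T a (f a + t)) \<longlongrightarrow> in_frame p T a (f a + 0)) (at_right 0)"
          unfolding in_frame_def by (intro tendsto_intros)
        moreover have "\<forall>\<^sub>F t in at_right 0. in_frame p T a (f a + t) \<in> \<Omega>"
          unfolding eventually_at_right_field
        proof (intro exI[of _ m] conjI allI impI m(1))
          fix t assume "0 < t" "t < m"
          then show "in_frame p T a (f a + t) \<in> \<Omega>"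
            using strip[OF ab(1), of "f a + t" "{0<..<m}"] upper by auto
        qed
        ultimately have "in_frame p T a (f a + 0) \<in> \<Omega>"
          by (intro Lim_in_closed_set[OF \<Omega>]) auto
        then show ?thesis using q 3 by simp
      qed
    qed
    then have "p \<in> interior \<Omega>" using m(1) by (intro interiorI[of "ball p (m / 2)"]) auto
    then show False using p by (simp add: frontier_def)
  qed
  show thesis
  proof (rule that)
    show "0 < m / 2" "m / 2 \<le> \<delta>" using m by auto
    show "in_frame p T a b \<in> \<Omega>" if "sqrt (a\<^sup>2 + b\<^sup>2) < m / 2" "f a < b" for a b
      using strip[OF near(1)[OF that(1)], of b "{0<..<m}"] near(2)[OF that(1)] that(2) upper by auto
    show "in_frame p T a b \<notin> \<Omega>" if "sqrt (a\<^sup>2 + b\<^sup>2) < m / 2" "b < f a" for a b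
      using strip[OF near(1)[OF that(1)], of b "{-m<..<0}"] near(2)[OF that(1)] that(2) lower by auto
  qed
qed


section \<open>The area of an epigraph inside a disk\<close>

lemma measurable_pair_to_real2 [measurable]:
  "(\<lambda>(x, y). vector [x, y] :: real^2) \<in> borel_measurable (lborel \<Otimes>\<^sub>M lborel)"
proof -
  have "continuous_on UNIV (\<lambda>z :: real \<times> real. if i = 1 then fst z else snd z)" for i :: 2
    by (cases "i = 1") (auto intro: continuous_intros)
  then have "continuous_on UNIV (\<lambda>z :: real \<times> real. \<chi> i. if i = 1 then fst z else snd z :: real^2)"
    by (rule continuous_on_vec_lambda)
  moreover have "(\<lambda>(x, y). vector [x, y] :: real^2) = (\<lambda>z. \<chi> i. if i = 1 then fst z else snd z)"
    by (auto simp: fun_eq_iff vec_eq_iff forall_2)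
  ultimately show ?thesis
    unfolding lborel_prod by (auto intro: borel_measurable_continuous_onI)
qed

lemma lborel_real2:
  "(lborel :: (real^2) measure) = distr (lborel \<Otimes>\<^sub>M lborel) borel (\<lambda>(x, y). vector [x, y])"
proof (rule lborel_eqI)
  fix l u :: "real^2" assume le: "\<And>b. b \<in> Basis \<Longrightarrow> l \<bullet> b \<le> u \<bullet> b"
  have le': "l $ i \<le> u $ i" for i using le[of "axis i 1"] by (simp add: inner_axis axis_in_Basis_iff)
  have "(\<lambda>(x, y). vector [x, y] :: real^2) -` box l u = {l$1<..<u$1} \<times> {l$2<..<u$2}"
    by (auto simp: mem_box_cart forall_2)
  then have "emeasure (distr (lborel \<Otimes>\<^sub>M lborel) borel (\<lambda>(x, y). vector [x, y])) (box l u) =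
      emeasure (lborel \<Otimes>\<^sub>M lborel) ({l$1<..<u$1} \<times> {l$2<..<u$2})"
    by (subst emeasure_distr) (simp_all add: space_pair_measure)
  also have "\<dots> = ennreal ((u$1 - l$1) * (u$2 - l$2))"
    by (subst lborel.emeasure_pair_measure_Times) (simp_all add: le' ennreal_mult)
  also have "(u$1 - l$1) * (u$2 - l$2) = (\<Prod>b\<in>Basis. (u - l) \<bullet> b)"
  proof -
    have "(Basis :: (real^2) set) = (\<lambda>i. axis i 1) ` UNIV" by (auto simp: Basis_vec_def)
    then have "(\<Prod>b\<in>Basis. (u - l) \<bullet> b) = (\<Prod>b\<in>range (\<lambda>i. axis i 1). (u - l) \<bullet> b)"
      by (rule arg_cong)
    also have "\<dots> = (\<Prod>i\<in>UNIV. (u - l) \<bullet> axis i 1)"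
      by (subst prod.reindex) (simp_all add: inj_on_def axis_eq_axis)
    finally show ?thesis by (simp add: UNIV_2 inner_axis)
  qed
  finally show "emeasure (distr (lborel \<Otimes>\<^sub>M lborel) borel (\<lambda>(x, y). vector [x, y])) (box l u) =
    ennreal (\<Prod>b\<in>Basis. (u - l) \<bullet> b)" .
qed simp

text \<open>
  Cavalieri's principle, transported from \<open>real \<times> real\<close> to \<open>real^2\<close>.
\<close>

lemma emeasure_real2_sections:
  fixes S :: "(real^2) set"
  assumes S: "S \<in> sets borel"
  shows "emeasure lborel S = (\<integral>\<^sup>+ u. emeasure lborel {v. vector [u, v] \<in> S} \<partial>lborel)"
    and "{v. vector [u, v] \<in> S} \<in> sets borel"
proof -
  define vec where "vec = (\<lambda>(x, y). vector [x, y] :: real^2)"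
  have meas: "vec \<in> borel_measurable (lborel \<Otimes>\<^sub>M lborel)"
    unfolding vec_def by (rule measurable_pair_to_real2)
  have vS: "vec -` S \<in> sets (lborel \<Otimes>\<^sub>M lborel)"
    using measurable_sets[OF meas S] by (simp add: space_pair_measure)
  have sec: "Pair u -` (vec -` S) = {v. vector [u, v] \<in> S}" for u by (auto simp: vec_def)
  have "emeasure lborel S = emeasure (lborel \<Otimes>\<^sub>M lborel) (vec -` S)"
    unfolding lborel_real2 vec_def[symmetric]
    using meas S by (subst emeasure_distr) (simp_all add: space_pair_measure)
  also have "\<dots> = (\<integral>\<^sup>+ u. emeasure lborel {v. vector [u, v] \<in> S} \<partial>lborel)"
    unfolding lborel.emeasure_pair_measure_alt[OF vS] sec ..
  finally show "emeasure lborel S = (\<integral>\<^sup>+ u. emeasure lborel {v. vector [u, v] \<in> S} \<partial>lborel)" .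
  show "{v. vector [u, v] \<in> S} \<in> sets borel"
    using sets_Pair1[OF vS, of u] by (simp add: sec)
qed

text \<open>
  A vertical section of the region is known only up to the graph point \<open>c\<close>, whose membership is left
  open; this does not affect its length.
\<close>

lemma emeasure_section:
  assumes w: "0 \<le> w" and V: "V \<in> sets borel"
    and sub: "\<And>v. v \<in> V \<Longrightarrow> \<bar>v\<bar> \<le> w \<and> c \<le> v"
    and sup: "\<And>v. \<bar>v\<bar> \<le> w \<Longrightarrow> c < v \<Longrightarrow> v \<in> V"
  shows "emeasure lborel V = ennreal (w - clip w c)"
proof (rule antisym)
  have le: "clip w c \<le> w" using w unfolding clip_def by linarith
  have "V \<subseteq> {clip w c..w}" using sub unfolding clip_def by fastforce
  then have "emeasure lborel V \<le> emeasure lborel {clip w c..w}" by (intro emeasure_mono) simp_all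
  then show "emeasure lborel V \<le> ennreal (w - clip w c)" using le by simp
  have "{clip w c<..w} \<subseteq> V"
  proof
    fix v assume "v \<in> {clip w c<..w}"
    then have "\<bar>v\<bar> \<le> w" "c < v" unfolding clip_def by auto
    then show "v \<in> V" by (rule sup)
  qed
  then have "emeasure lborel {clip w c<..w} \<le> emeasure lborel V"
    using V by (intro emeasure_mono) simp_all
  then show "ennreal (w - clip w c) \<le> emeasure lborel V" using le by simp
qed

lemma orthogonal_transformation_in_frame:
  assumes "norm T = 1"
  shows "orthogonal_transformation (\<lambda>z :: real^2. in_frame 0 T (z $ 1) (z $ 2))"
proof -
  have "linear (\<lambda>z :: real^2. in_frame 0 T (z $ 1) (z $ 2))"
    by (rule linearI) (simp_all add: in_frame_def algebra_simps)
  moreover have "norm (in_frame 0 T (z $ 1) (z $ 2)) = norm z" for z :: "real^2"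
    using dist_in_frame[OF assms, of 0 "z $ 1" "z $ 2"]
    by (simp add: norm_eq_sqrt_inner[of z] inner_vec_def sum_2 power2_eq_square)
  ultimately show ?thesis by (simp add: orthogonal_transformation)
qed

text \<open>
  The disk is carried to the unit disk by a similarity that also turns the frame into the coordinate
  axes; Cavalieri's principle then gives the integral of the chord lengths.
\<close>

lemma area_of_epigraph_in_disk:
  fixes f :: "real \<Rightarrow> real"
  assumes \<Omega>: "closed \<Omega>" and T: "norm T = 1" and r: "0 < r" "r < \<rho>"
    and above: "\<And>a b. sqrt (a\<^sup>2 + b\<^sup>2) < \<rho> \<Longrightarrow> f a < b \<Longrightarrow> in_frame p T a b \<in> \<Omega>"
    and below: "\<And>a b. sqrt (a\<^sup>2 + b\<^sup>2) < \<rho> \<Longrightarrow> b < f a \<Longrightarrow> in_frame p T a b \<notin> \<Omega>"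
    and int: "(\<lambda>u. sqrt (1 - u\<^sup>2) - clip (sqrt (1 - u\<^sup>2)) (f (r * u) / r)) integrable_on {-1..1}"
  shows "measure lebesgue (\<Omega> \<inter> cball p r) = r\<^sup>2 * area_above_graph f r"
proof -
  define A where "A z = in_frame 0 T (z $ 1) (z $ 2)" for z :: "real^2"
  have A: "orthogonal_transformation A"
    unfolding A_def by (rule orthogonal_transformation_in_frame[OF T])
  have pA: "r *\<^sub>R A z + p = in_frame p T (r * z $ 1) (r * z $ 2)" for z
    by (simp add: A_def in_frame_def algebra_simps)
  have contA: "continuous_on X A" for X
    using A by (intro linear_continuous_on) (simp add: orthogonal_transformation_linear linear_conv_bounded_linear[symmetric])
  define S where "S = {z :: real^2. norm z \<le> 1 \<and> r *\<^sub>R A z + p \<in> \<Omega>}"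
  have "closed {z. r *\<^sub>R A z + p \<in> \<Omega>}"
    using continuous_closed_vimage[OF \<Omega>, of "\<lambda>z. r *\<^sub>R A z + p"] contA[of UNIV]
    by (simp add: vimage_def continuous_on_eq_continuous_at continuous_intros)
  moreover have "S = cball 0 1 \<inter> {z. r *\<^sub>R A z + p \<in> \<Omega>}" by (auto simp: S_def)
  ultimately have "compact S" by (simp add: compact_Int_closed)
  have "\<Omega> \<inter> cball p r = (\<lambda>x. r *\<^sub>R x + p) ` A ` S"
  proof (intro equalityI subsetI)
    fix q assume q: "q \<in> \<Omega> \<inter> cball p r"
    obtain z where z: "A z = (q - p) /\<^sub>R r"
      using orthogonal_transformation_surj[OF A] by (metis surjD)
    then have "r *\<^sub>R A z + p = q" using r by simp
    moreover have "norm z \<le> 1"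
    proof -
      have "norm z = norm (q - p) / r"
        using orthogonal_transformation_norm[OF A, of z] r unfolding z by (simp add: divide_inverse mult.commute)
      then show ?thesis using q r by (simp add: dist_norm norm_minus_commute)
    qed
    ultimately have "z \<in> S" using q by (simp add: S_def)
    with \<open>r *\<^sub>R A z + p = q\<close> show "q \<in> (\<lambda>x. r *\<^sub>R x + p) ` A ` S" by blast
  next
    fix q assume "q \<in> (\<lambda>x. r *\<^sub>R x + p) ` A ` S"
    then obtain z where z: "z \<in> S" "q = r *\<^sub>R A z + p" by blast
    have "dist p q = r * norm z"
      using z(2) r orthogonal_transformation_norm[OF A, of z] by (simp add: dist_norm)
    then show "q \<in> \<Omega> \<inter> cball p r" using z r by (simp add: S_def mult_left_le)
  qed
  then have "measure lebesgue (\<Omega> \<inter> cball p r) = r\<^sup>2 * measure lebesgue (A ` S)"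
    using measure_lebesgue_affine[of r p "A ` S"] by simp
  also have "measure lebesgue (A ` S) = measure lebesgue S"
    using \<open>compact S\<close> by (intro measure_orthogonal_image A lmeasurable_compact)
  also have "measure lebesgue S = area_above_graph f r"
  proof -
    define w where "w u = sqrt (1 - u\<^sup>2)" for u :: real
    define h where "h u = w u - clip (w u) (f (r * u) / r)" for u
    have S: "S \<in> sets borel" using \<open>compact S\<close> by (intro borel_compact)
    have mem: "vector [u, v] \<in> S \<longleftrightarrow> u\<^sup>2 + v\<^sup>2 \<le> 1 \<and> in_frame p T (r * u) (r * v) \<in> \<Omega>" for u v
      by (simp add: S_def pA norm_eq_sqrt_inner inner_vec_def sum_2 power2_eq_square)
    have w0: "0 \<le> w u" if "u \<in> {-1..1}" for u
      using that by (simp add: w_def abs_square_le_1 abs_le_iff)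
    have disk: "u\<^sup>2 + v\<^sup>2 \<le> 1 \<longleftrightarrow> \<bar>v\<bar> \<le> w u" for u v
      by (simp add: w_def real_le_rsqrt sqrt_ge_absD) (metis add.commute le_diff_eq real_sqrt_abs real_sqrt_le_iff)
    have inside: "sqrt ((r * u)\<^sup>2 + (r * v)\<^sup>2) < \<rho>" if "u\<^sup>2 + v\<^sup>2 \<le> 1" for u v
    proof -
      have "sqrt ((r * u)\<^sup>2 + (r * v)\<^sup>2) = r * sqrt (u\<^sup>2 + v\<^sup>2)"
        using r by (simp add: power_mult_distrib real_sqrt_mult flip: distrib_left)
      also have "\<dots> \<le> r" using that r by (simp add: mult_left_le)
      finally show ?thesis using r by simp
    qed
    have sec: "emeasure lborel {v. vector [u, v] \<in> S} = ennreal (indicator {-1..1} u * h u)" for u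
    proof (cases "u \<in> {-1..1}")
      case True
      have "emeasure lborel {v. vector [u, v] \<in> S} = ennreal (w u - clip (w u) (f (r * u) / r))"
      proof (rule emeasure_section)
        show "0 \<le> w u" by (rule w0[OF True])
        show "{v. vector [u, v] \<in> S} \<in> sets borel" by (rule emeasure_real2_sections(2)[OF S])
        show "\<bar>v\<bar> \<le> w u \<and> f (r * u) / r \<le> v" if "v \<in> {v. vector [u, v] \<in> S}" for v
        proof -
          have *: "u\<^sup>2 + v\<^sup>2 \<le> 1" "in_frame p T (r * u) (r * v) \<in> \<Omega>" using that by (simp_all add: mem)
          then have "\<not> r * v < f (r * u)" using below[OF inside[OF *(1)]] by blast
          then show ?thesis using *(1) r by (simp add: disk divide_le_eq mult.commute)
        qed
        show "v \<in> {v. vector [u, v] \<in> S}" if "\<bar>v\<bar> \<le> w u" "f (r * u) / r < v" for v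
        proof -
          have *: "u\<^sup>2 + v\<^sup>2 \<le> 1" using that(1) by (simp add: disk)
          have "f (r * u) < r * v" using that(2) r by (simp add: divide_less_eq mult.commute)
          then show ?thesis using above[OF inside[OF *]] * by (simp add: mem)
        qed
      qed
      then show ?thesis using True by (simp add: h_def)
    next
      case False
      then have "1 < u\<^sup>2" using abs_square_le_1[of u] by (auto simp: abs_le_iff)
      then have "{v. vector [u, v] \<in> S} = {}"
        using zero_le_power2 by (simp add: mem) (smt (verit) zero_le_power2)
      then show ?thesis using False by simp
    qed
    have "emeasure lborel S = (\<integral>\<^sup>+ u. ennreal (indicator {-1..1} u * h u) \<partial>lborel)"
      unfolding emeasure_real2_sections(1)[OF S] sec ..
    also have "\<dots> = ennreal (area_above_graph f r)"
    proof (rule nn_integral_has_integral_lebesgue)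
      show "0 \<le> h u" if "u \<in> {-1..1}" for u using w0[OF that] unfolding h_def clip_def by linarith
      show "(h has_integral area_above_graph f r) {-1..1}"
        unfolding area_above_graph_def h_def w_def by (rule integrable_integral[OF int])
    qed
    finally have "emeasure lborel S = ennreal (area_above_graph f r)" .
    moreover have "0 \<le> area_above_graph f r"
      unfolding area_above_graph_def
    proof (rule integral_nonneg[OF int])
      fix u :: real assume "u \<in> {-1..1}"
      from w0[OF this] show "0 \<le> sqrt (1 - u\<^sup>2) - clip (sqrt (1 - u\<^sup>2)) (f (r * u) / r)"
        unfolding w_def clip_def by linarith
    qed
    ultimately show ?thesis using S by (simp add: measure_def)
  qed
  finally show ?thesis .
qed

section \<open>Simple closed curves do not return close to a point\<close>

lemma periodic_int_shift:
  fixes \<gamma> :: "real \<Rightarrow> 'a"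
  assumes per: "\<And>s. \<gamma> (s + L) = \<gamma> s"
  shows "\<gamma> (s + of_int n * L) = \<gamma> s"
proof (induction n arbitrary: s rule: int_induct[where k = 0])
  case (step1 n)
  have "\<gamma> (s + of_int (n + 1) * L) = \<gamma> ((s + of_int n * L) + L)" by (simp add: algebra_simps)
  then show ?case using per step1 by metis
next
  case (step2 n)
  have "\<gamma> (s + of_int (n - 1) * L) = \<gamma> ((s + of_int (n - 1) * L) + L)" by (rule per[symmetric])
  also have "(s + of_int (n - 1) * L) + L = s + of_int n * L" by (simp add: algebra_simps)
  finally show ?case using step2 by metis
qed simp

lemma shift_into_period:
  fixes L x :: real
  assumes "0 < L"
  obtains n :: int where "x - of_int n * L \<in> {0..<L}"
proof
  show "x - of_int \<lfloor>x / L\<rfloor> * L \<in> {0..<L}"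
    using floor_divide_lower[OF assms, of x] floor_divide_upper[OF assms, of x]
    by (simp add: algebra_simps)
qed

text \<open>
  The part of the curve at parameter distance at least \<open>\<eta>\<close> from \<open>s\<close> is compact and, by injectivity,
  avoids \<open>\<gamma> s\<close>; hence it keeps a positive distance from \<open>\<gamma> s\<close>.
\<close>

lemma simple_closed_curve_near_point:
  fixes \<gamma> :: "real \<Rightarrow> 'a::heine_borel"
  assumes L: "0 < L" and per: "\<And>s. \<gamma> (s + L) = \<gamma> s" and inj: "inj_on \<gamma> {0..<L}"
    and cont: "continuous_on UNIV \<gamma>" and \<eta>: "0 < \<eta>"
  obtains d where "0 < d"
    "\<And>q. q \<in> range \<gamma> \<Longrightarrow> dist q (\<gamma> s) < d \<Longrightarrow> \<exists>t. \<bar>t\<bar> < \<eta> \<and> q = \<gamma> (s + t)"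
proof -
  define K where "K = \<gamma> ` {s + \<eta>..s + L - \<eta>}"
  have red: "\<exists>n :: int. x - of_int n * L \<in> {0..<L}" for x
    using shift_into_period[OF L] by blast
  have shift: "\<gamma> (x - of_int n * L) = \<gamma> x" for x and n :: int
    using periodic_int_shift[of \<gamma> L x "- n", OF per] by simp
  have "\<gamma> s \<notin> K"
  proof
    assume "\<gamma> s \<in> K"
    then obtain b where b: "s + \<eta> \<le> b" "b \<le> s + L - \<eta>" "\<gamma> s = \<gamma> b" by (auto simp: K_def)
    obtain m n :: int where mn: "s - of_int m * L \<in> {0..<L}" "b - of_int n * L \<in> {0..<L}"
      using red by blast
    then have "s - of_int m * L = b - of_int n * L"
      by (intro inj_onD[OF inj]) (simp_all add: shift b(3))
    then have k: "b - s = of_int (n - m) * L" by (simp add: algebra_simps)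
    then have "0 < of_int (n - m) * L" "of_int (n - m) * L < 1 * L" using b \<eta> by linarith+
    then have "0 < real_of_int (n - m)" "real_of_int (n - m) < 1"
      using L mult_less_cancel_right_pos[OF L] zero_less_mult_pos2[OF _ L] by blast+
    then have "0 < n - m" "n - m < 1" by linarith+
    then show False by simp
  qed
  moreover have "closed K"
    unfolding K_def by (intro compact_imp_closed compact_continuous_image continuous_on_subset[OF cont]) auto
  ultimately obtain d where d: "0 < d" "\<And>q. q \<in> K \<Longrightarrow> d \<le> dist (\<gamma> s) q"
    using separate_point_closed[of K "\<gamma> s"] by blast
  show thesis
  proof (rule that[OF d(1)])
    fix q assume "q \<in> range \<gamma>" and q: "dist q (\<gamma> s) < d"
    then obtain x where x: "q = \<gamma> x" by blast
    obtain n :: int where n: "(x - s) - of_int n * L \<in> {0..<L}" using red by blast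
    define t where "t = (x - s) - of_int n * L"
    have t: "0 \<le> t" "t < L" "q = \<gamma> (s + t)"
      using n shift[of x n] x by (simp_all add: t_def)
    have "q \<notin> K" using d(2)[of q] q by (auto simp: dist_commute)
    then have "\<not> (\<eta> \<le> t \<and> t \<le> L - \<eta>)" using t(3) by (auto simp: K_def)
    then consider "t < \<eta>" | "L - \<eta> < t" by linarith
    then show "\<exists>t. \<bar>t\<bar> < \<eta> \<and> q = \<gamma> (s + t)"
    proof cases
      case 1
      then show ?thesis using t by (intro exI[of _ t]) simp
    next
      case 2
      have "q = \<gamma> (s + (t - L))" using t(3) per[of "s + (t - L)"] by simp
      then show ?thesis using 2 t(2) by (intro exI[of _ "t - L"]) simp
    qed
  qed
qed

section \<open>Curvature from disk areas\<close>

lemma has_real_derivative_component: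
  assumes "(c has_vector_derivative v) (at (s + t))"
  shows "((\<lambda>t. (c (s + t) - p) \<bullet> w) has_real_derivative v \<bullet> w) (at t)"
proof -
  have "((\<lambda>u. (c u - p) \<bullet> w) has_vector_derivative (v - 0) \<bullet> w) (at (t + s))"
    using assms by (intro bounded_linear.has_vector_derivative[OF bounded_linear_inner_left]
        has_vector_derivative_diff has_vector_derivative_const) (simp add: add.commute)
  then have "((\<lambda>u. (c u - p) \<bullet> w) has_real_derivative v \<bullet> w) (at (t + s))"
    by (simp add: has_real_derivative_iff_has_vector_derivative)
  then show ?thesis unfolding DERIV_shift by (simp add: add.commute)
qed

lemma C1_curve_has_vector_derivative:
  assumes "c C1_differentiable_on UNIV"
  shows "(c has_vector_derivative velocity c t) (at t)"
  using assms by (auto simp: C1_differentiable_on_eq velocity_def vector_derivative_works)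

text \<open>
  The local picture: in the frame at \<open>\<gamma> s\<close> the region is an epigraph near the origin, so for small
  radii the area ratio is \<open>area_above_graph f r / pi\<close>, whose derivative is already known.
\<close>

lemma density_derivative_at_boundary_point:
  assumes "C2_region \<Omega> L \<gamma>"
  obtains \<delta> G where "0 < \<delta>"
    "\<And>r. 0 < r \<Longrightarrow> r < \<delta> \<Longrightarrow>
      ((\<lambda>\<rho>. disk_area \<Omega> \<gamma> s \<rho> / (pi * \<rho>\<^sup>2)) has_real_derivative G r) (at r)"
    "(G \<longlongrightarrow> - signed_curvature \<gamma> s / (3 * pi)) (at_right 0)"
proof -
  have comp: "compact \<Omega>" and L: "0 < L" and per: "\<And>s. \<gamma> (s + L) = \<gamma> s"
    and inj: "inj_on \<gamma> {0..<L}" and unit: "\<And>s. norm (velocity \<gamma> s) = 1"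
    and C2: "\<gamma> C1_differentiable_on UNIV" "velocity \<gamma> C1_differentiable_on UNIV"
    and front: "frontier \<Omega> = \<gamma> ` {0..<L}" and left: "interior_on_left \<Omega> \<gamma>"
    using assms by (simp_all add: C2_region_def simple_closed_arclength_curve_def C2_curve_def)
  define p where "p = \<gamma> s"
  define T where "T = velocity \<gamma> s"
  have T: "norm T = 1" unfolding T_def by (rule unit)
  note ortho = rot90_orthonormal[OF T]
  have d\<gamma>: "(\<gamma> has_vector_derivative velocity \<gamma> t) (at t)" for t
    by (rule C1_curve_has_vector_derivative[OF C2(1)])
  have dv: "(velocity \<gamma> has_vector_derivative acceleration \<gamma> t) (at t)" for t
    using C1_curve_has_vector_derivative[OF C2(2)] by (simp add: velocity_def acceleration_def)
  define x where "x t = (\<gamma> (s + t) - p) \<bullet> T" for t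
  define y where "y t = (\<gamma> (s + t) - p) \<bullet> rot90 T" for t
  define x' where "x' t = (velocity \<gamma> (s + t) - 0) \<bullet> T" for t
  define y' where "y' t = (velocity \<gamma> (s + t) - 0) \<bullet> rot90 T" for t
  have dx: "(x has_real_derivative x' t) (at t)" and dy: "(y has_real_derivative y' t) (at t)" for t
    using has_real_derivative_component[OF d\<gamma>] by (simp_all add: x_def[abs_def] x'_def y_def[abs_def] y'_def)
  have "(x' has_real_derivative acceleration \<gamma> (s + 0) \<bullet> T) (at 0)"
    unfolding x'_def[abs_def] by (rule has_real_derivative_component[OF dv])
  then have cont: "isCont x' 0" by (rule DERIV_isCont)
  have "(y' has_real_derivative acceleration \<gamma> (s + 0) \<bullet> rot90 T) (at 0)"
    unfolding y'_def[abs_def] by (rule has_real_derivative_component[OF dv])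
  then have d2y: "(y' has_real_derivative signed_curvature \<gamma> s) (at 0)"
    by (simp add: signed_curvature_def T_def)
  have zero: "x 0 = 0" "y 0 = 0" "x' 0 = 1" "y' 0 = 0"
    using ortho by (simp_all add: x_def y_def x'_def y'_def p_def T_def)
  obtain \<eta> \<delta> C f f' where \<eta>: "0 < \<eta>" and \<delta>: "0 < \<delta>" and f0: "f 0 = 0" "f' 0 = 0"
    and graph: "\<And>t. \<bar>t\<bar> \<le> \<eta> \<Longrightarrow> y t = f (x t)"
    and df: "\<And>a. \<bar>a\<bar> < \<delta> \<Longrightarrow> (f has_real_derivative f' a) (at a)"
    and slope: "\<And>a. \<bar>a\<bar> < \<delta> \<Longrightarrow> \<bar>f' a\<bar> \<le> 1/2"
    and bnd: "\<And>a. \<bar>a\<bar> < \<delta> \<Longrightarrow> \<bar>bend f f' a\<bar> \<le> C"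
    and blim: "(bend f f' \<longlongrightarrow> signed_curvature \<gamma> s / 2) (at 0)"
    by (rule curve_is_graph[OF dx dy zero cont d2y], rule that)
  have cont_\<gamma>: "continuous_on UNIV \<gamma>"
    using d\<gamma> by (intro continuous_at_imp_continuous_on ballI has_vector_derivative_continuous)
  obtain d where d: "0 < d"
    and near: "\<And>q. q \<in> range \<gamma> \<Longrightarrow> dist q p < d \<Longrightarrow> \<exists>t. \<bar>t\<bar> < \<eta> \<and> q = \<gamma> (s + t)"
    by (rule simple_closed_curve_near_point[OF L per inj cont_\<gamma> \<eta>, of s, folded p_def], rule that)
  have on_graph: "\<exists>a. q = in_frame p T a (f a)" if q: "q \<in> frontier \<Omega>" "dist q p < d" for q
  proof -
    have "q \<in> range \<gamma>" using q(1) front by blast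
    then obtain t where t: "\<bar>t\<bar> < \<eta>" "q = \<gamma> (s + t)" using near q(2) by blast
    have "q = in_frame p T (x t) (y t)" unfolding t(2) x_def y_def by (rule in_frame_surj[OF T, symmetric])
    then show ?thesis using graph[of t] t(1) by (intro exI[of _ "x t"]) simp
  qed
  have p: "p \<in> frontier \<Omega>"
  proof -
    obtain n :: int where "s - of_int n * L \<in> {0..<L}" by (rule shift_into_period[OF L])
    moreover have "\<gamma> (s - of_int n * L) = p"
      using periodic_int_shift[of \<gamma> L s "- n", OF per] by (simp add: p_def)
    ultimately show ?thesis unfolding front by (metis imageI)
  qed
  have cont_f: "continuous_on {-\<delta><..<\<delta>} f"
    by (rule DERIV_continuous_on[where D=f'], rule has_field_derivative_at_within, rule df)
      (simp add: abs_less_iff)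
  have f_le: "\<bar>f a\<bar> \<le> \<bar>a\<bar>" if "\<bar>a\<bar> < \<delta>" for a
    using lipschitz_graph[OF df slope that, of 0] \<delta> f0 by simp
  have inward: "\<forall>\<^sub>F t in at_right 0. in_frame p T 0 t \<in> \<Omega>"
  proof -
    have "\<forall>\<^sub>F t in at_right 0. p + t *\<^sub>R rot90 T \<in> interior \<Omega>"
      using left by (simp add: interior_on_left_def p_def T_def)
    then show ?thesis
      by (rule eventually_mono) (use interior_subset in \<open>auto simp: in_frame_def\<close>)
  qed
  obtain \<rho> where \<rho>: "0 < \<rho>" "\<rho> \<le> \<delta>"
    and above: "\<And>a b. sqrt (a\<^sup>2 + b\<^sup>2) < \<rho> \<Longrightarrow> f a < b \<Longrightarrow> in_frame p T a b \<in> \<Omega>"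
    and below: "\<And>a b. sqrt (a\<^sup>2 + b\<^sup>2) < \<rho> \<Longrightarrow> b < f a \<Longrightarrow> in_frame p T a b \<notin> \<Omega>"
  proof (rule region_is_epigraph_near[OF compact_imp_closed[OF comp] p T \<delta> d cont_f])
    show "\<bar>f a\<bar> \<le> \<bar>a\<bar>" if "\<bar>a\<bar> < \<delta>" for a using that by (rule f_le)
    show "\<exists>a. q = in_frame p T a (f a)" if "q \<in> frontier \<Omega>" "dist q p < d" for q
      using that by (rule on_graph)
    show "\<forall>\<^sub>F t in at_right 0. in_frame p T 0 t \<in> \<Omega>" by (rule inward)
  qed (rule that)
  obtain G where G: "\<And>r. 0 < r \<Longrightarrow> r < \<delta> \<Longrightarrow> (area_above_graph f has_real_derivative G r) (at r)"
    and Glim: "(G \<longlongrightarrow> - signed_curvature \<gamma> s / 3) (at_right 0)"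
    by (rule area_above_graph_deriv_limit[OF f0(1) \<delta> df slope bnd f0(2) blim])
      (assumption | rule that)+
  have area: "area_above_graph f r / pi = disk_area \<Omega> \<gamma> s r / (pi * r\<^sup>2)" if "r \<in> {0<..<\<rho>}" for r
  proof -
    have r: "0 < r" "r < \<rho>" "r < \<delta>" using that \<rho> by auto
    have "disk_area \<Omega> \<gamma> s r = r\<^sup>2 * area_above_graph f r"
      unfolding disk_area_def p_def[symmetric]
      by (rule area_of_epigraph_in_disk[OF compact_imp_closed[OF comp] T r(1,2) above below
            area_above_graph_integrable[OF df r(1,3)]])
    then show ?thesis using r by simp
  qed
  show thesis
  proof (rule that[of \<rho> "\<lambda>r. G r / pi"])
    show "0 < \<rho>" by fact
    show "((\<lambda>\<rho>. disk_area \<Omega> \<gamma> s \<rho> / (pi * \<rho>\<^sup>2)) has_real_derivative G r / pi) (at r)"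
      if "0 < r" "r < \<rho>" for r
    proof (rule has_field_derivative_transform_within_open[OF _ _ _ area])
      show "((\<lambda>r. area_above_graph f r / pi) has_real_derivative G r / pi) (at r)"
        using G[of r] that \<rho> by (intro DERIV_cdivide) simp
      show "open {0<..<\<rho>}" "r \<in> {0<..<\<rho>}" using that by simp_all
    qed
    have "((\<lambda>r. G r / pi) \<longlongrightarrow> - signed_curvature \<gamma> s / 3 / pi) (at_right 0)"
      by (intro tendsto_intros Glim) simp
    then show "((\<lambda>r. G r / pi) \<longlongrightarrow> - signed_curvature \<gamma> s / (3 * pi)) (at_right 0)" by simp
  qed
qed

lemma curvature_from_density:
  fixes s :: real
  assumes "C2_region \<Omega> L \<gamma>"
  defines "D \<equiv> deriv (\<lambda>\<rho>. disk_area \<Omega> \<gamma> s \<rho> / (pi * \<rho>\<^sup>2))"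
  shows "\<forall>\<^sub>F r in at_right 0. (\<lambda>\<rho>. disk_area \<Omega> \<gamma> s \<rho> / (pi * \<rho>\<^sup>2)) field_differentiable at r"
    and "(D \<longlongrightarrow> - signed_curvature \<gamma> s / (3 * pi)) (at_right 0)"
proof -
  obtain \<delta> G where \<delta>: "0 < \<delta>"
    and der: "\<And>r. 0 < r \<Longrightarrow> r < \<delta> \<Longrightarrow>
      ((\<lambda>\<rho>. disk_area \<Omega> \<gamma> s \<rho> / (pi * \<rho>\<^sup>2)) has_real_derivative G r) (at r)"
    and lim: "(G \<longlongrightarrow> - signed_curvature \<gamma> s / (3 * pi)) (at_right 0)"
    by (rule density_derivative_at_boundary_point[OF assms(1), of s], rule that)
  have ev: "\<forall>\<^sub>F r in at_right 0. 0 < r \<and> r < \<delta>"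
    using \<delta> unfolding eventually_at_right_field by blast
  show "\<forall>\<^sub>F r in at_right 0. (\<lambda>\<rho>. disk_area \<Omega> \<gamma> s \<rho> / (pi * \<rho>\<^sup>2)) field_differentiable at r"
    using ev by (rule eventually_mono) (use der in \<open>auto simp: field_differentiable_def\<close>)
  have "\<forall>\<^sub>F r in at_right 0. G r = D r"
    using ev
  proof (rule eventually_mono)
    fix r assume "0 < r \<and> r < \<delta>"
    then show "G r = D r" unfolding D_def by (intro DERIV_imp_deriv[symmetric] der) simp_all
  qed
  with lim show "(D \<longlongrightarrow> - signed_curvature \<gamma> s / (3 * pi)) (at_right 0)"
    by (rule Lim_transform_eventually)
qed

text \<open>
  The limit formula depends only on the germ of the area function at radius 0.
\<close>

lemma curvature_determined_by_disk_areas: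
  assumes "C2_region \<Omega> L \<gamma>" "C2_region \<Omega>' L' \<gamma>'" and \<epsilon>: "0 < \<epsilon>"
    and same: "\<And>r. 0 < r \<Longrightarrow> r < \<epsilon> \<Longrightarrow> disk_area \<Omega>' \<gamma>' s r = disk_area \<Omega> \<gamma> s r"
  shows "signed_curvature \<gamma>' s = signed_curvature \<gamma> s"
proof -
  define g where "g \<rho> = disk_area \<Omega> \<gamma> s \<rho> / (pi * \<rho>\<^sup>2)" for \<rho>
  define g' where "g' \<rho> = disk_area \<Omega>' \<gamma>' s \<rho> / (pi * \<rho>\<^sup>2)" for \<rho>
  have "\<forall>\<^sub>F r in at_right 0. 0 < r \<and> r < \<epsilon>"
    using \<epsilon> unfolding eventually_at_right_field by blast
  then have "\<forall>\<^sub>F r in at_right 0. deriv g' r = deriv g r"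
  proof (rule eventually_mono)
    fix r assume r: "0 < r \<and> r < \<epsilon>"
    have "\<forall>\<^sub>F \<rho> in nhds r. g' \<rho> = g \<rho>"
      by (rule eventually_nhds_in_open[of "{0<..<\<epsilon>}", THEN eventually_mono])
        (use r same in \<open>auto simp: g_def g'_def\<close>)
    then show "deriv g' r = deriv g r" by (intro deriv_cong_ev refl)
  qed
  with curvature_from_density(2)[OF assms(2), of s, folded g'_def[abs_def]]
  have "(deriv g \<longlongrightarrow> - signed_curvature \<gamma>' s / (3 * pi)) (at_right 0)"
    by (rule Lim_transform_eventually)
  with curvature_from_density(2)[OF assms(1), of s, folded g_def[abs_def]]
  have "- signed_curvature \<gamma> s / (3 * pi) = - signed_curvature \<gamma>' s / (3 * pi)"
    by (intro tendsto_unique) auto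
  then show ?thesis by simp
qed

theorem theorem29:
  fixes \<Omega> :: "(real^2) set" and L :: real and \<gamma> :: "real \<Rightarrow> real^2"
  assumes "C2_region \<Omega> L \<gamma>"
  shows "(\<forall>\<Omega>' \<gamma>' \<epsilon>. \<epsilon> > 0 \<and> C2_region \<Omega>' L \<gamma>' \<and>
            (\<forall>s\<in>{0..<L}. \<forall>r\<in>{0<..<\<epsilon>}. disk_area \<Omega>' \<gamma>' s r = disk_area \<Omega> \<gamma> s r) \<longrightarrow>
            (\<forall>s\<in>{0..<L}. signed_curvature \<gamma>' s = signed_curvature \<gamma> s)) \<and>
         (\<forall>s\<in>{0..<L}.
            (\<forall>\<^sub>F r in at_right 0.
               (\<lambda>\<rho>. disk_area \<Omega> \<gamma> s \<rho> / (pi * \<rho>\<^sup>2)) field_differentiable at r) \<and>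
            (\<exists>l. ((\<lambda>r. deriv (\<lambda>\<rho>. disk_area \<Omega> \<gamma> s \<rho> / (pi * \<rho>\<^sup>2)) r) \<longlongrightarrow> l) (at_right 0) \<and>
                 signed_curvature \<gamma> s = - 3 * pi * l))"
proof (intro conjI allI impI ballI)
  fix \<Omega>' \<gamma>' and \<epsilon> s :: real
  assume "\<epsilon> > 0 \<and> C2_region \<Omega>' L \<gamma>' \<and>
    (\<forall>s\<in>{0..<L}. \<forall>r\<in>{0<..<\<epsilon>}. disk_area \<Omega>' \<gamma>' s r = disk_area \<Omega> \<gamma> s r)" "s \<in> {0..<L}"
  then show "signed_curvature \<gamma>' s = signed_curvature \<gamma> s"
    by (intro curvature_determined_by_disk_areas[OF assms, of \<Omega>' L \<gamma>' \<epsilon>]) simp_all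
next
  fix s
  show "\<forall>\<^sub>F r in at_right 0. (\<lambda>\<rho>. disk_area \<Omega> \<gamma> s \<rho> / (pi * \<rho>\<^sup>2)) field_differentiable at r"
    by (rule curvature_from_density(1)[OF assms])
  have "signed_curvature \<gamma> s = - 3 * pi * (- signed_curvature \<gamma> s / (3 * pi))" by simp
  with curvature_from_density(2)[OF assms, of s]
  show "\<exists>l. ((\<lambda>r. deriv (\<lambda>\<rho>. disk_area \<Omega> \<gamma> s \<rho> / (pi * \<rho>\<^sup>2)) r) \<longlongrightarrow> l) (at_right 0) \<and>
      signed_curvature \<gamma> s = - 3 * pi * l"
    by blast
qed

end
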